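(* Let $a,b,c$ be constants with $a+b+c=0$, $b\neq0$, $c\neq0$, and consider the general heavenly equation $$a\,u_{xy}u_{zt}+b\,u_{xz}u_{yt}+c\,u_{xt}u_{yz}=0$$ for a scalar function $u$ of $x,y,z,t$ (where $u_{zt}\neq 0$). Then the relations $$\tilde U_x=\frac{u_{xz}U_t+c\,u_{xt}\tilde U_z-u_{zt}U_x}{c\,u_{zt}},\qquad \tilde U_y=-\frac{u_{yz}U_t-b\,u_{yt}\tilde U_z-u_{zt}U_y}{b\,u_{zt}}$$ define a recursion operator for this equation: whenever $U$ is a (possibly nonlocal) symmetry of the equation, so is $\tilde U$ defined by these relations.
   Context: Subscripts $x,y,z,t$ denote partial (total) derivatives. A (possibly nonlocal) symmetry of the equation is a solution $U$ of the linearized equation $$a u_{xy}U_{zt}+a u_{zt}U_{xy}+b u_{xz}U_{yt}+b u_{yt}U_{xz}+c u_{xt}U_{yz}+c u_{yz}U_{xt}=0,$$ required to hold by virtue of the equation for $u$ and its differential consequences. Here $U$ may depend on $x,y,z,t$, on $u$ and finitely many of its derivatives, and possibly also on nonlocal variables, i.e. on additional variables to which the total derivatives are extended so that they still commute (a differential covering). $\tilde U$ may involve further nonlocal variables. All functions are assumed locally meromorphic in their arguments. A recursion operator is understood as a Bäcklund auto-transformation of the linearized equation, i.e. a system of relations between $U$ and $\tilde U$ sending solutions $U$ to solutions $\tilde U$. *)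

theory Defs
  imports "HOL-Analysis.Analysis" "HOL-Library.Multiset"
begin

text \<open>
  Coordinates of the infinite jet space of one function \<open>u\<close> of \<open>x, y, z, t\<close>, extended by
  nonlocal variables indexed by an arbitrary type. \<open>Jet \<alpha>\<close> is the derivative of \<open>u\<close>
  by the multiset \<open>\<alpha>\<close> of independent variables, so \<open>Jet {#}\<close> is \<open>u\<close> itself.
  Points are families of complex numbers; open sets are those of the product topology,
  so an open set restricts only finitely many coordinates near each of its points.
\<close>

datatype dir = Dx | Dy | Dz | Dt

datatype 'v coord = Indep dir | Jet "dir multiset" | Nonloc 'v

type_synonym 'v point = "'v coord \<Rightarrow> complex"

type_synonym 'v field_coeffs = "dir \<Rightarrow> 'v \<Rightarrow> 'v point \<Rightarrow> complex"

definition du :: "dir list \<Rightarrow> 'v point \<Rightarrow> complex" where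
  "du ds q = q (Jet (mset ds))"

definition pd :: "'v coord \<Rightarrow> ('v point \<Rightarrow> complex) \<Rightarrow> 'v point \<Rightarrow> complex" where
  "pd k f q = deriv (\<lambda>s. f (q(k := s))) (q k)"

text \<open>
  The total derivative in direction \<open>i\<close>, where \<open>A i v\<close> is the prescribed total
  derivative of the nonlocal variable \<open>v\<close>:
  \<open>\<partial>\<^sub>i + (\<Sum>\<alpha>. u\<^sub>\<alpha>\<^sub>+\<^sub>i \<partial>/\<partial>u\<^sub>\<alpha>) + (\<Sum>v. A i v \<partial>/\<partial>v)\<close>.
  Near a point where \<open>f\<close> depends on finitely many coordinates, only finitely many terms
  are nonzero.
\<close>

fun field_coeff :: "'v field_coeffs \<Rightarrow> dir \<Rightarrow> 'v coord \<Rightarrow> 'v point \<Rightarrow> complex" where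
  "field_coeff A i (Indep j) q = (if i = j then 1 else 0)"
| "field_coeff A i (Jet \<alpha>) q = q (Jet (add_mset i \<alpha>))"
| "field_coeff A i (Nonloc v) q = A i v q"

definition total_der ::
  "'v field_coeffs \<Rightarrow> dir \<Rightarrow> ('v point \<Rightarrow> complex) \<Rightarrow> 'v point \<Rightarrow> complex" where
  "total_der A i f q = (\<Sum>k | pd k f q \<noteq> 0. field_coeff A i k q * pd k f q)"

definition jet_der :: "dir \<Rightarrow> ('v point \<Rightarrow> complex) \<Rightarrow> 'v point \<Rightarrow> complex" where
  "jet_der = total_der (\<lambda>_ _ _. 0)"

text \<open>
  Functions of finitely many coordinates. Continuous and separately holomorphic is the same
  as holomorphic, by Osgood's lemma.
\<close>

definition depends_on :: "'v coord set \<Rightarrow> 'v point set \<Rightarrow> ('v point \<Rightarrow> complex) \<Rightarrow> bool" where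
  "depends_on S V f \<longleftrightarrow> (\<forall>q\<in>V. \<forall>q'\<in>V. (\<forall>k\<in>S. q k = q' k) \<longrightarrow> f q = f q')"

definition holo :: "'v coord set \<Rightarrow> 'v point set \<Rightarrow> ('v point \<Rightarrow> complex) \<Rightarrow> bool" where
  "holo S V f \<longleftrightarrow> finite S \<and> depends_on S V f \<and> continuous_on V f \<and>
     (\<forall>q\<in>V. \<forall>k. (\<lambda>s. f (q(k := s))) field_differentiable at (q k))"

text \<open>
  An equation \<open>F = 0\<close>, its differential consequences, and the set of points where they all
  hold.
\<close>

definition consequence :: "('v point \<Rightarrow> complex) \<Rightarrow> dir list \<Rightarrow> 'v point \<Rightarrow> complex" where
  "consequence F ds = foldr jet_der ds F"

definition eqn_manifold :: "('v point \<Rightarrow> complex) \<Rightarrow> 'v point set" where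
  "eqn_manifold F = {q. \<forall>ds. consequence F ds q = 0}"

text \<open>
  Meromorphic functions on the equation manifold are represented by total functions on the
  ambient space whose values at poles are irrelevant: near each point of the manifold they are
  quotients of holomorphic functions, the denominator not being identically zero on any
  nonempty relatively open part of the manifold.
\<close>

definition denominator ::
  "('v point \<Rightarrow> complex) \<Rightarrow> 'v point set \<Rightarrow> ('v point \<Rightarrow> complex) \<Rightarrow> bool" where
  "denominator F V h \<longleftrightarrow> (\<exists>S. holo S V h) \<and>
     (\<forall>W. open W \<and> W \<subseteq> V \<and> W \<inter> eqn_manifold F \<noteq> {} \<longrightarrow> (\<exists>q\<in>W \<inter> eqn_manifold F. h q \<noteq> 0))"

definition loc_mero ::
  "('v point \<Rightarrow> complex) \<Rightarrow> 'v point set \<Rightarrow> ('v point \<Rightarrow> complex) \<Rightarrow> bool" where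
  "loc_mero F \<Omega> f \<longleftrightarrow> (\<exists>S. finite S \<and> (\<forall>p \<in> \<Omega> \<inter> eqn_manifold F. \<exists>V g h.
     open V \<and> p \<in> V \<and> holo S V g \<and> holo S V h \<and> denominator F V h \<and>
     (\<forall>q\<in>V. h q \<noteq> 0 \<longrightarrow> f q = g q / h q)))"

text \<open>
  \<open>f = 0\<close> by virtue of the equation and its differential consequences: locally, up to a
  denominator, \<open>f\<close> is a finite linear combination of the consequences of \<open>F\<close> with
  holomorphic coefficients.
\<close>

definition vanishes ::
  "('v point \<Rightarrow> complex) \<Rightarrow> 'v point set \<Rightarrow> ('v point \<Rightarrow> complex) \<Rightarrow> bool" where
  "vanishes F \<Omega> f \<longleftrightarrow> (\<forall>p \<in> \<Omega> \<inter> eqn_manifold F. \<exists>V h L r.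
     open V \<and> p \<in> V \<and> denominator F V h \<and> finite L \<and> (\<forall>ds\<in>L. \<exists>S. holo S V (r ds)) \<and>
     (\<forall>q\<in>V. h q \<noteq> 0 \<longrightarrow> f q = (\<Sum>ds\<in>L. r ds q * consequence F ds q) / h q))"

text \<open>
  On functions of the jet coordinates alone the total derivatives always commute, so a
  covering only has to make them commute on the nonlocal variables.
\<close>

definition diff_covering ::
  "('v point \<Rightarrow> complex) \<Rightarrow> 'v point set \<Rightarrow> 'v field_coeffs \<Rightarrow> bool" where
  "diff_covering F \<Omega> A \<longleftrightarrow> open \<Omega> \<and> (\<forall>i v. loc_mero F \<Omega> (A i v)) \<and>
     (\<forall>i j v. vanishes F \<Omega> (\<lambda>q.
        total_der A i (total_der A j (\<lambda>p. p (Nonloc v))) q -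
        total_der A j (total_der A i (\<lambda>p. p (Nonloc v))) q))"

text \<open>
  Adjoining further nonlocal variables, indexed by \<open>'w\<close>: the bigger covering projects onto
  the smaller one by forgetting them.
\<close>

definition forget :: "('v + 'w) point \<Rightarrow> 'v point" where
  "forget q = (\<lambda>k. q (map_coord Inl k))"

definition ghe :: "complex \<Rightarrow> complex \<Rightarrow> complex \<Rightarrow> 'v point \<Rightarrow> complex" where
  "ghe a b c q = a * du [Dx, Dy] q * du [Dz, Dt] q + b * du [Dx, Dz] q * du [Dy, Dt] q
     + c * du [Dx, Dt] q * du [Dy, Dz] q"

definition covering_extension ::
  "complex \<Rightarrow> complex \<Rightarrow> complex \<Rightarrow> 'v point set \<Rightarrow> 'v field_coeffs \<Rightarrow>
   ('v + 'w) point set \<Rightarrow> ('v + 'w) field_coeffs \<Rightarrow> bool" where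
  "covering_extension a b c \<Omega> A \<Omega>' A' \<longleftrightarrow>
     diff_covering (ghe a b c) \<Omega>' A' \<and> forget ` \<Omega>' = \<Omega> \<and>
     (\<forall>i v. \<forall>q\<in>\<Omega>'. A' i (Inl v) q = A i v (forget q))"

definition lin_ghe ::
  "complex \<Rightarrow> complex \<Rightarrow> complex \<Rightarrow> 'v field_coeffs \<Rightarrow> ('v point \<Rightarrow> complex) \<Rightarrow> 'v point \<Rightarrow> complex" where
  "lin_ghe a b c A U q = (let D = total_der A in
       a * du [Dx, Dy] q * D Dt (D Dz U) q + a * du [Dz, Dt] q * D Dy (D Dx U) q
     + b * du [Dx, Dz] q * D Dt (D Dy U) q + b * du [Dy, Dt] q * D Dz (D Dx U) q
     + c * du [Dx, Dt] q * D Dz (D Dy U) q + c * du [Dy, Dz] q * D Dt (D Dx U) q)"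

text \<open>
  A local symmetry is the special case in which \<open>U\<close> does not involve the coordinates
  \<open>Nonloc v\<close> (with, for instance, \<open>A = 0\<close>).
\<close>

definition symmetry ::
  "complex \<Rightarrow> complex \<Rightarrow> complex \<Rightarrow> 'v point set \<Rightarrow> 'v field_coeffs \<Rightarrow> ('v point \<Rightarrow> complex) \<Rightarrow> bool" where
  "symmetry a b c \<Omega> A U \<longleftrightarrow>
     loc_mero (ghe a b c) \<Omega> U \<and> vanishes (ghe a b c) \<Omega> (lin_ghe a b c A U)"

definition recursion_relations ::
  "complex \<Rightarrow> complex \<Rightarrow> complex \<Rightarrow> 'v point set \<Rightarrow> 'v field_coeffs \<Rightarrow>
   ('v point \<Rightarrow> complex) \<Rightarrow> ('v point \<Rightarrow> complex) \<Rightarrow> bool" where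
  "recursion_relations a b c \<Omega> A U U' \<longleftrightarrow> (let D = total_der A in
     vanishes (ghe a b c) \<Omega> (\<lambda>q. D Dx U' q -
       (du [Dx, Dz] q * D Dt U q + c * du [Dx, Dt] q * D Dz U' q - du [Dz, Dt] q * D Dx U q)
         / (c * du [Dz, Dt] q)) \<and>
     vanishes (ghe a b c) \<Omega> (\<lambda>q. D Dy U' q -
       (- ((du [Dy, Dz] q * D Dt U q - b * du [Dy, Dt] q * D Dz U' q - du [Dz, Dt] q * D Dy U q)
         / (b * du [Dz, Dt] q)))))"

end

theory Submission
  imports Defs "HOL-Complex_Analysis.Cauchy_Integral_Formula"
begin

text \<open>
  The functions that vanish by virtue of the equation form an ideal of the meromorphic functions,
  stable under the total derivatives, and modulo it the total derivatives commute on all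
  meromorphic functions; this uses the symmetry of mixed partial derivatives and hence Cauchy's
  integral formula. The first half is then an identity: up to the factor \<open>c u\<^sub>z\<^sub>t\<^sup>2\<close>
  the linearized equation for \<open>U'\<close> is a linear combination of the two relations, of their
  derivatives, of the equation, of its \<open>z\<close>- and \<open>t\<close>-derivatives, of the linearized equation for
  \<open>U\<close> and of commutators.

  For existence take \<open>m = u\<^sub>t\<close> as a coordinate in place of \<open>z\<close>. The relations become
  \<open>X\<^sub>x U' = f\<close>, \<open>X\<^sub>y U' = g\<close>, where \<open>X\<^sub>x, X\<^sub>y, X\<^sub>t, \<partial>\<^sub>m\<close> commute and \<open>f, g\<close> do not involve \<open>U'\<close>;
  they are compatible, \<open>X\<^sub>y f = X\<^sub>x g\<close>, because \<open>U\<close> is a symmetry. So the derivatives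
  \<open>\<partial>\<^sub>m\<^sup>r X\<^sub>t\<^sup>s U'\<close> can be adjoined as free nonlocal variables.
\<close>

text \<open>The coordinate m = u_t is dictated by the relations: besides \<open>U\<close> they
  involve only U'_x - (u_xt/u_zt) U'_z and U'_y - (u_yt/u_zt) U'_z, and these combinations of total
  derivatives kill u_t. Since u_zt \<noteq> 0, m can replace z. The relations leave U'_z and U'_t
  undetermined, so the new covering carries infinitely many variables. Plain z- and t-derivatives of
  U' would bring Leibniz terms from u_xt/u_zt into every differentiated relation; in the commuting
  frame each prolonged right-hand side is again free of U'. The condition a + b + c = 0 shows in the
  leading terms: for instance it gives -(a + b) = c for the yz-derivative of U' in the first half
  and -(b + c) = a for U_xy in the compatibility condition. What shapes the formal proof is that
  \<open>vanishes\<close> means membership in an ideal, not zero values on the manifold, so explicit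
  combinations must be exhibited. Moreover meromorphic functions have arbitrary values at poles,
  where even the product rule can fail. So identities are checked at generic points and transferred
  by \<open>vanishes_cong\<close>.\<close>

section \<open>Separately holomorphic functions\<close>

text \<open>Over a compact disc \<open>g x\<close> is uniformly close to \<open>g x0\<close> for
  \<open>x\<close> near \<open>x0\<close>, and Cauchy's estimate turns this into closeness of the
  derivatives. The parameter lives in an arbitrary topological space because \<open>holo_pd\<close>
  uses whole jet points as parameters, and an uncountable power of the complex plane is not
  metrizable.\<close>

lemma continuous_on_deriv_param:
  fixes g :: "'a::topological_space \<Rightarrow> complex \<Rightarrow> complex"
  assumes U: "open U" and B: "open B"
    and cont: "continuous_on (U \<times> B) (\<lambda>(x, t). g x t)"
    and hol: "\<And>x. x \<in> U \<Longrightarrow> g x holomorphic_on B"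
  shows "continuous_on (U \<times> B) (\<lambda>(x, t). deriv (g x) t)"
proof -
  have "((\<lambda>(x, t). deriv (g x) t) \<longlongrightarrow> deriv (g x0) t0) (at (x0, t0))"
    if x0: "x0 \<in> U" and t0: "t0 \<in> B" for x0 t0
  proof (rule tendstoI)
    fix e :: real assume "e > 0"
    obtain R where R: "R > 0" "cball t0 R \<subseteq> B"
      using B t0 open_contains_cball by blast
    define r where "r = R / 2"
    have r: "r > 0" "cball t0 (2 * r) \<subseteq> B" using R by (auto simp: r_def)
    have contC: "continuous_on (U \<times> cball t0 (2 * r)) (\<lambda>(x, t). g x t)"
      by (rule continuous_on_subset[OF cont]) (use r in auto)
    \<comment> \<open>The disc of radius \<open>2 * r\<close> contains the disc of radius
      \<open>r\<close> about every \<open>t\<close> within \<open>r\<close> of \<open>t0\<close>.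
      Cauchy's estimate divides by \<open>r\<close>, so this bound becomes \<open>e / 4\<close>; the
      other half of \<open>e\<close> pays for moving \<open>t\<close> to \<open>t0\<close>.\<close>
    have "e * r / 4 > 0" using \<open>e > 0\<close> r by simp
    from continuous_on_prod_compactE[OF contC compact_cball x0 this]
    obtain X0 where X0: "x0 \<in> X0" "open X0"
      and bd: "\<forall>x\<in>X0 \<inter> U. \<forall>t\<in>cball t0 (2 * r).
        dist (case (x, t) of (x, t) \<Rightarrow> g x t) (case (x0, t) of (x, t) \<Rightarrow> g x t) \<le> e * r / 4" .
    then have bound: "dist (g x t) (g x0 t) \<le> e * r / 4" if "x \<in> X0 \<inter> U" "t \<in> cball t0 (2 * r)" for x t
      using that by simp
    have "isCont (deriv (g x0)) t0"
      by (rule field_differentiable_imp_continuous_at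
            [OF holomorphic_on_imp_differentiable_at[OF holomorphic_deriv[OF hol[OF x0] B] B t0]])
    then obtain d where d: "d > 0" "\<And>t. dist t t0 < d \<Longrightarrow> dist (deriv (g x0) t) (deriv (g x0) t0) < e / 2"
      using \<open>e > 0\<close> unfolding continuous_at_eps_delta by (metis half_gt_zero)
    define N where "N = (X0 \<inter> U) \<times> ball t0 (min d r)"
    have "open N" "(x0, t0) \<in> N"
      using X0 U x0 d(1) r(1) by (auto simp: N_def intro!: open_Times)
    moreover have "dist (case p of (x, t) \<Rightarrow> deriv (g x) t) (deriv (g x0) t0) < e" if "p \<in> N" for p
    proof -
      obtain x t where p: "p = (x, t)" by (cases p)
      have x: "x \<in> X0 \<inter> U" and t: "dist t t0 < d" "dist t0 t < r"
        using that by (auto simp: N_def p dist_commute)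
      have sub: "cball t r \<subseteq> cball t0 (2 * r)"
      proof
        fix s assume "s \<in> cball t r"
        then show "s \<in> cball t0 (2 * r)"
          using t(2) dist_triangle[of t0 s t] by simp
      qed
      have hol': "(\<lambda>s. g x s - g x0 s) holomorphic_on B"
        using hol x x0 by (intro holomorphic_intros) auto
      have "t \<in> B" using subsetD[OF sub, of t] r by auto
      have diff: "g x field_differentiable at t" "g x0 field_differentiable at t"
        using hol x x0 B \<open>t \<in> B\<close> holomorphic_on_imp_differentiable_at by (metis IntD2)+
      have "norm ((deriv ^^ 1) (\<lambda>s. g x s - g x0 s) t) \<le> fact 1 * (e * r / 4) / r ^ 1"
      proof (rule Cauchy_inequality)
        have sB: "cball t r \<subseteq> B" "ball t r \<subseteq> B"
          using subset_trans[OF sub r(2)] ball_subset_cball[of t r] by blast+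
        show "(\<lambda>s. g x s - g x0 s) holomorphic_on ball t r"
          using holomorphic_on_subset[OF hol'] sB by blast
        show "continuous_on (cball t r) (\<lambda>s. g x s - g x0 s)"
          using continuous_on_subset[OF holomorphic_on_imp_continuous_on[OF hol']] sB by blast
        show "norm (g x s - g x0 s) \<le> e * r / 4" if "norm (t - s) = r" for s
          using bound[OF x, of s] sub that by (auto simp: dist_norm subset_iff)
      qed (use r in auto)
      then have "norm (deriv (g x) t - deriv (g x0) t) \<le> e / 4"
        using r(1) diff by simp
      then have "dist (deriv (g x) t) (deriv (g x0) t) < e / 2"
        using \<open>e > 0\<close> by (simp add: dist_norm)
      then show ?thesis
        using d(2)[OF t(1)] dist_triangle[of "deriv (g x) t" "deriv (g x0) t0" "deriv (g x0) t"]
        unfolding p by simp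
    qed
    ultimately show "\<forall>\<^sub>F p in at (x0, t0). dist (case p of (x, t) \<Rightarrow> deriv (g x) t) (deriv (g x0) t0) < e"
      unfolding eventually_at_topological by blast
  qed
  then show ?thesis
    unfolding continuous_on_def by (auto intro: Lim_at_imp_Lim_at_within)
qed

text \<open>The weight in Cauchy's formula for the derivative at \<open>z\<close>, pulled back to
  the unit interval. It does not depend on the function integrated, so a parameter of that function
  can be differentiated under the integral.\<close>

definition cauchy_kernel :: "complex \<Rightarrow> real \<Rightarrow> real \<Rightarrow> complex" where
  "cauchy_kernel z r \<theta> =
     vector_derivative (circlepath z r) (at \<theta>) / (circlepath z r \<theta> - z)^2 / (2 * pi * \<i>)"

lemma deriv_circlepath_integral:
  assumes "f holomorphic_on S" "cball z r \<subseteq> S" "r > 0"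
  shows "deriv f z = integral (cbox 0 1) (\<lambda>\<theta>. f (circlepath z r \<theta>) *
           cauchy_kernel z r \<theta>)"
proof -
  have "contour_integral (circlepath z r) (\<lambda>u. f u/(u - z)^2) = (2 * pi * \<i>) * deriv f z"
    using assms
    by (intro Cauchy_contour_integral_circlepath_2)
       (meson ball_subset_cball centre_in_ball continuous_on_subset holomorphic_on_imp_continuous_on
          holomorphic_on_subset subset_trans)+
  then have "deriv f z = contour_integral (circlepath z r) (\<lambda>u. f u/(u - z)^2) / (2 * pi * \<i>)"
    by simp
  also have "\<dots> = integral (cbox 0 1) (\<lambda>\<theta>. f (circlepath z r \<theta>) / (circlepath z r \<theta> - z)^2 *
           vector_derivative (circlepath z r) (at \<theta>)) / (2 * pi * \<i>)"
    by (simp add: contour_integral_integral)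
  also have "\<dots> = integral (cbox 0 1) (\<lambda>\<theta>. f (circlepath z r \<theta>) / (circlepath z r \<theta> - z)^2 *
           vector_derivative (circlepath z r) (at \<theta>) / (2 * pi * \<i>))"
    by (simp only: integral_divide)
  also have "\<dots> = integral (cbox 0 1) (\<lambda>\<theta>. f (circlepath z r \<theta>) *
           cauchy_kernel z r \<theta>)"
    by (rule integral_cong) (simp add: cauchy_kernel_def field_simps)
  finally show ?thesis .
qed

text \<open>Cauchy's formula writes the \<open>s\<close>-derivative as an integral, which the
  Leibniz rule differentiates in \<open>t\<close>. The value is kept as an integral over an explicit
  circle so that the formula can afterwards be read backwards.\<close>

lemma deriv_param_has_derivative:
  fixes g :: "complex \<Rightarrow> complex \<Rightarrow> complex"
  assumes A: "open A" and B: "open B"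
    and cont: "continuous_on (A \<times> B) (\<lambda>(s, t). g s t)"
    and hol1: "\<And>t. t \<in> B \<Longrightarrow> (\<lambda>s. g s t) holomorphic_on A"
    and hol2: "\<And>s. s \<in> A \<Longrightarrow> g s holomorphic_on B"
    and s0: "s0 \<in> A" and t0: "t0 \<in> B"
  shows "\<exists>r>0. cball s0 r \<subseteq> A \<and>
    ((\<lambda>t. deriv (\<lambda>s. g s t) s0) has_field_derivative
       integral (cbox 0 1) (\<lambda>\<theta>. deriv (g (circlepath s0 r \<theta>)) t0 *
           cauchy_kernel s0 r \<theta>)) (at t0)"
proof -
  obtain r where r: "r > 0" "cball s0 r \<subseteq> A" using A s0 open_contains_cball by blast
  obtain R where R: "R > 0" "ball t0 R \<subseteq> B" using B t0 open_contains_ball by blast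
  let ?c = "circlepath s0 r"
  define w where "w = cauchy_kernel s0 r"
  have path: "?c \<theta> \<in> A" for \<theta>
  proof -
    have "?c \<theta> \<in> cball s0 r" using r(1) by (simp add: circlepath dist_norm norm_mult)
    then show ?thesis using r by blast
  qed
  have ne: "?c \<theta> - s0 \<noteq> 0" for \<theta> using r(1) by (simp add: circlepath)
  have contc: "continuous_on S ?c" for S unfolding circlepath by (intro continuous_intros)
  have contw: "continuous_on S w" for S
    unfolding w_def cauchy_kernel_def vector_derivative_circlepath using ne
    by (intro continuous_intros contc) auto
  have contd: "continuous_on (A \<times> B) (\<lambda>(s, t). deriv (g s) t)"
    by (rule continuous_on_deriv_param[OF A B cont hol2])
  have contd': "continuous_on (ball t0 R \<times> cbox 0 1) (\<lambda>(t, \<theta>). deriv (g (?c \<theta>)) t * w \<theta>)"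
  proof -
    have "continuous_on (ball t0 R \<times> cbox 0 1) (\<lambda>p. (\<lambda>(s, t). deriv (g s) t) (?c (snd p), fst p))"
      by (rule continuous_on_compose2[OF contd])
         (use R path in \<open>auto intro!: continuous_intros continuous_on_compose2[OF contc]\<close>)
    then show ?thesis
      by (auto simp: case_prod_unfold intro!: continuous_intros continuous_on_compose2[OF contw])
  qed
  have cont1: "continuous_on (cbox 0 1) (\<lambda>\<theta>. g (?c \<theta>) t * w \<theta>)" if "t \<in> B" for t
  proof -
    have "continuous_on (cbox 0 1) (\<lambda>\<theta>. (\<lambda>(s, t). g s t) (?c \<theta>, t))"
      by (rule continuous_on_compose2[OF cont])
         (use that path in \<open>auto intro!: continuous_intros continuous_on_compose2[OF contc]\<close>)
    then show ?thesis by (auto intro!: continuous_intros contw)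
  qed
  have "((\<lambda>t. integral (cbox 0 1) (\<lambda>\<theta>. g (?c \<theta>) t * w \<theta>)) has_field_derivative
        integral (cbox 0 1) (\<lambda>\<theta>. deriv (g (?c \<theta>)) t0 * w \<theta>)) (at t0 within ball t0 R)"
  proof (rule leibniz_rule_field_derivative[OF _ _ contd'])
    show "((\<lambda>t. g (?c \<theta>) t * w \<theta>) has_field_derivative deriv (g (?c \<theta>)) t * w \<theta>) (at t within ball t0 R)"
      if "t \<in> ball t0 R" "\<theta> \<in> cbox 0 1" for t \<theta>
      using holomorphic_derivI[OF hol2[OF path] B, of t] that R
      by (intro DERIV_cmult_right) blast
    show "(\<lambda>\<theta>. g (?c \<theta>) t * w \<theta>) integrable_on cbox 0 1" if "t \<in> ball t0 R" for t
      using cont1[of t] that R by (intro integrable_continuous) auto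
  qed (use R in auto)
  then have "((\<lambda>t. integral (cbox 0 1) (\<lambda>\<theta>. g (?c \<theta>) t * w \<theta>)) has_field_derivative
        integral (cbox 0 1) (\<lambda>\<theta>. deriv (g (?c \<theta>)) t0 * w \<theta>)) (at t0)"
    using R by (simp add: at_within_open[OF _ open_ball])
  then have "((\<lambda>t. deriv (\<lambda>s. g s t) s0) has_field_derivative
        integral (cbox 0 1) (\<lambda>\<theta>. deriv (g (?c \<theta>)) t0 * w \<theta>)) (at t0)"
    by (rule has_field_derivative_transform_within_open[OF _ B t0])
       (simp only: w_def deriv_circlepath_integral[OF hol1 r(2,1)])
  then show ?thesis using r unfolding w_def by (intro exI[of _ r] conjI)
qed

text \<open>The integral from \<open>deriv_param_has_derivative\<close> is Cauchy's formula for the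
  \<open>s\<close>-derivative of \<open>\<lambda>s. deriv (g s) t0\<close>. That function is
  holomorphic by the same lemma with the two variables exchanged.\<close>

lemma deriv_deriv_commute:
  fixes g :: "complex \<Rightarrow> complex \<Rightarrow> complex"
  assumes A: "open A" and B: "open B"
    and cont: "continuous_on (A \<times> B) (\<lambda>(s, t). g s t)"
    and hol1: "\<And>t. t \<in> B \<Longrightarrow> (\<lambda>s. g s t) holomorphic_on A"
    and hol2: "\<And>s. s \<in> A \<Longrightarrow> g s holomorphic_on B"
    and s0: "s0 \<in> A" and t0: "t0 \<in> B"
  shows "(\<lambda>t. deriv (\<lambda>s. g s t) s0) field_differentiable at t0"
    and "deriv (\<lambda>t. deriv (\<lambda>s. g s t) s0) t0 = deriv (\<lambda>s. deriv (g s) t0) s0"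
proof -
  have "\<exists>r>0. cball s0 r \<subseteq> A \<and>
    ((\<lambda>t. deriv (\<lambda>s. g s t) s0) has_field_derivative
       integral (cbox 0 1) (\<lambda>\<theta>. deriv (g (circlepath s0 r \<theta>)) t0 * cauchy_kernel s0 r \<theta>)) (at t0)"
    by (rule deriv_param_has_derivative[of A B g s0 t0, OF A B cont]) (use hol1 hol2 s0 t0 in auto)
  then obtain r where r: "r > 0" "cball s0 r \<subseteq> A" and
    D: "((\<lambda>t. deriv (\<lambda>s. g s t) s0) has_field_derivative
       integral (cbox 0 1) (\<lambda>\<theta>. deriv (g (circlepath s0 r \<theta>)) t0 * cauchy_kernel s0 r \<theta>)) (at t0)"
    by blast
  from D show "(\<lambda>t. deriv (\<lambda>s. g s t) s0) field_differentiable at t0"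
    by (auto simp: field_differentiable_def)
  have cont': "continuous_on (B \<times> A) (\<lambda>(t, s). g s t)"
  proof -
    have "continuous_on (B \<times> A) (\<lambda>p. (\<lambda>(s, t). g s t) (snd p, fst p))"
      by (rule continuous_on_compose2[OF cont]) (auto intro!: continuous_intros)
    then show ?thesis by (simp add: case_prod_unfold)
  qed
  have "(\<lambda>s. deriv (g s) t0) holomorphic_on A"
    unfolding holomorphic_on_def
  proof
    fix s assume "s \<in> A"
    then have "\<exists>r>0. cball t0 r \<subseteq> B \<and>
      ((\<lambda>s. deriv (\<lambda>t. g s t) t0) has_field_derivative
         integral (cbox 0 1) (\<lambda>\<theta>. deriv (\<lambda>s. g s (circlepath t0 r \<theta>)) s * cauchy_kernel t0 r \<theta>)) (at s)"
      by (intro deriv_param_has_derivative[of B A "\<lambda>t s. g s t" t0 s, OF B A cont']) (use hol1 hol2 t0 in auto)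
    then obtain D where "((\<lambda>s. deriv (g s) t0) has_field_derivative D) (at s)" by blast
    then show "(\<lambda>s. deriv (g s) t0) field_differentiable at s within A"
      unfolding field_differentiable_def using DERIV_subset[of _ _ s UNIV A] by blast
  qed
  note eq = deriv_circlepath_integral[OF this r(2,1)]
  show "deriv (\<lambda>t. deriv (\<lambda>s. g s t) s0) t0 = deriv (\<lambda>s. deriv (g s) t0) s0"
    by (simp only: eq DERIV_imp_deriv[OF D])
qed

section \<open>Holomorphic functions of finitely many coordinates\<close>

lemma continuous_on_fun_upd:
  fixes q :: "'a::topological_space \<Rightarrow> 'v point"
  assumes "continuous_on X q" "continuous_on X s"
  shows "continuous_on X (\<lambda>x. (q x)(k := s x))"
proof (rule continuous_on_coordinatewise_then_product)
  show "continuous_on X (\<lambda>x. ((q x)(k := s x)) i)" for i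
    using assms continuous_on_product_then_coordinatewise[OF assms(1), of i] by (cases "i = k") auto
qed

lemma holo_finite: "holo S V f \<Longrightarrow> finite S"
  by (simp add: holo_def)

lemma holo_continuous: "holo S V f \<Longrightarrow> continuous_on V f"
  by (simp add: holo_def)

lemma holo_diff_at: "holo S V f \<Longrightarrow> q \<in> V \<Longrightarrow> (\<lambda>s. f (q(k := s))) field_differentiable at (q k)"
  by (simp add: holo_def)

lemma holo_depends: "holo S V f \<Longrightarrow> q \<in> V \<Longrightarrow> q' \<in> V \<Longrightarrow> (\<And>k. k \<in> S \<Longrightarrow> q k = q' k) \<Longrightarrow> f q = f q'"
  unfolding holo_def depends_on_def by blast

lemma holo_mono: "holo S V f \<Longrightarrow> S \<subseteq> S' \<Longrightarrow> finite S' \<Longrightarrow> V' \<subseteq> V \<Longrightarrow> holo S' V' f"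
  unfolding holo_def depends_on_def by (meson continuous_on_subset subset_iff)

lemma eventually_fun_upd_in_open:
  fixes q :: "'v point"
  assumes "open V" "q \<in> V"
  shows "\<forall>\<^sub>F s in nhds (q k). q(k := s) \<in> V"
proof -
  have "continuous_on UNIV (\<lambda>s. q(k := s))"
    by (intro continuous_on_fun_upd continuous_on_const continuous_on_fst continuous_on_snd continuous_on_id)
  then have "open ((\<lambda>s. q(k := s)) -` V)"
    using assms(1) by (simp add: continuous_on_open_vimage)
  then show ?thesis
    using eventually_nhds_in_open[of "(\<lambda>s. q(k := s)) -` V" "q k"] assms(2) by simp
qed

lemma pd_cong:
  assumes "open V" "q \<in> V" "\<And>p. p \<in> V \<Longrightarrow> f p = g p"
  shows "pd k f q = pd k g q"
  unfolding pd_def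
  by (rule deriv_cong_ev[OF eventually_mono[OF eventually_fun_upd_in_open[OF assms(1,2)]] refl])
     (use assms(3) in auto)

lemma holo_cong:
  assumes "open V" "\<And>p. p \<in> V \<Longrightarrow> f p = g p" "holo S V f"
  shows "holo S V g"
proof -
  have "(\<lambda>s. g (q(k := s))) field_differentiable at (q k)" if q: "q \<in> V" for q k
  proof -
    have ev: "\<forall>\<^sub>F s in nhds (q k). f (q(k := s)) = g (q(k := s))"
      using eventually_fun_upd_in_open[OF assms(1) q] by eventually_elim (use assms(2) in auto)
    obtain D where "((\<lambda>s. f (q(k := s))) has_field_derivative D) (at (q k))"
      using holo_diff_at[OF assms(3) q] by (auto simp: field_differentiable_def)
    then have "((\<lambda>s. g (q(k := s))) has_field_derivative D) (at (q k))"
      using DERIV_cong_ev[OF refl ev refl] by blast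
    then show ?thesis by (auto simp: field_differentiable_def)
  qed
  moreover have "continuous_on V g"
    using holo_continuous[OF assms(3)] assms(2) continuous_on_cong by fastforce
  moreover have "depends_on S V g"
    using assms(2,3) unfolding holo_def depends_on_def by (metis (no_types, lifting))
  ultimately show ?thesis using assms(3) by (simp add: holo_def)
qed

lemma holo_const [simp, intro]: "holo {} V (\<lambda>_. c)"
  by (simp add: holo_def depends_on_def)

lemma holo_const': "finite S \<Longrightarrow> holo S V (\<lambda>_. c)"
  by (simp add: holo_def depends_on_def)

lemma holo_coord [intro]: "holo {k} V (\<lambda>q. q k)"
proof -
  have "(\<lambda>s. (q(j := s)) k) field_differentiable at (q j)" for q :: "'a point" and j
    by (cases "j = k") auto
  moreover have "continuous_on V (\<lambda>q. q k)"
    by (rule continuous_on_subset[OF continuous_on_product_coordinates]) auto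
  ultimately show ?thesis by (simp add: holo_def depends_on_def)
qed

lemma depends_on_compose2:
  "depends_on S V f \<Longrightarrow> depends_on S V g \<Longrightarrow> depends_on S V (\<lambda>q. F (f q) (g q))"
  unfolding depends_on_def by (blast intro: arg_cong2[where f = F])

lemma holo_add: "holo S V f \<Longrightarrow> holo S V g \<Longrightarrow> holo S V (\<lambda>q. f q + g q)"
  unfolding holo_def
  by (simp add: depends_on_compose2 continuous_on_add field_differentiable_add)

lemma holo_diff: "holo S V f \<Longrightarrow> holo S V g \<Longrightarrow> holo S V (\<lambda>q. f q - g q)"
  unfolding holo_def
  by (simp add: depends_on_compose2 continuous_on_diff field_differentiable_diff)

lemma holo_mult: "holo S V f \<Longrightarrow> holo S V g \<Longrightarrow> holo S V (\<lambda>q. f q * g q)"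
  unfolding holo_def
  by (simp add: depends_on_compose2 continuous_on_mult field_differentiable_mult)

lemma holo_divide: "holo S V f \<Longrightarrow> holo S V g \<Longrightarrow> (\<And>q. q \<in> V \<Longrightarrow> g q \<noteq> 0) \<Longrightarrow> holo S V (\<lambda>q. f q / g q)"
  unfolding holo_def
  by (simp add: depends_on_compose2 continuous_on_divide field_differentiable_divide)

lemma holo_sum: "finite S \<Longrightarrow> (\<And>i. i \<in> I \<Longrightarrow> holo S V (f i)) \<Longrightarrow> holo S V (\<lambda>q. \<Sum>i\<in>I. f i q)"
  by (induction I rule: infinite_finite_induct) (auto intro: holo_const' holo_add)

section \<open>Partial derivatives of holomorphic functions\<close>

lemma pd_eq_0:
  assumes "open V" "holo S V f" "q \<in> V" "k \<notin> S"
  shows "pd k f q = 0"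
proof -
  have "\<forall>\<^sub>F s in nhds (q k). f (q(k := s)) = f q"
    using eventually_fun_upd_in_open[OF assms(1,3)]
    by eventually_elim (rule holo_depends[OF assms(2)], use assms in auto)
  then have "pd k f q = deriv (\<lambda>_. f q) (q k)"
    unfolding pd_def by (rule deriv_cong_ev) simp
  then show ?thesis by simp
qed

lemma pd_const [simp]: "pd k (\<lambda>_. c) q = 0"
  by (simp add: pd_def)

lemma pd_coord: "pd k (\<lambda>q. q j) q = (if k = j then 1 else 0)"
  by (auto simp: pd_def)

lemma pd_add:
  assumes "holo S V f" "holo S V g" "q \<in> V"
  shows "pd k (\<lambda>q. f q + g q) q = pd k f q + pd k g q"
  unfolding pd_def using holo_diff_at[OF assms(1,3)] holo_diff_at[OF assms(2,3)] by simp

lemma pd_mult: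
  assumes "holo S V f" "holo S V g" "q \<in> V"
  shows "pd k (\<lambda>q. f q * g q) q = f q * pd k g q + pd k f q * g q"
  unfolding pd_def using holo_diff_at[OF assms(1,3)] holo_diff_at[OF assms(2,3)] by (subst deriv_mult) simp_all

lemma pd_divide:
  assumes "holo S V f" "holo S V g" "q \<in> V" "g q \<noteq> 0"
  shows "pd k (\<lambda>q. f q / g q) q = (pd k f q * g q - f q * pd k g q) / (g q * g q)"
  unfolding pd_def using holo_diff_at[OF assms(1,3)] holo_diff_at[OF assms(2,3)] assms(4)
  by (subst deriv_divide) (simp_all add: power2_eq_square)

text \<open>Freezing all coordinates but \<open>k\<close> and \<open>l\<close> reduces
  differentiability and commutation to functions of one or two complex variables. Continuity
  concerns all coordinates at once and comes from \<open>continuous_on_deriv_param\<close> with the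
  whole point as parameter.\<close>

lemma
  assumes V: "open V" and f: "holo S V f"
  shows holo_pd: "holo S V (pd k f)"
    and pd_commute: "q \<in> V \<Longrightarrow> pd l (pd k f) q = pd k (pd l f) q"
proof -
  have upd: "continuous_on X (\<lambda>x::'a point \<times> complex. (fst x)(k := snd x))" for X k
    by (intro continuous_on_fun_upd continuous_on_const continuous_on_fst continuous_on_snd continuous_on_id)
  have box: "\<exists>N. \<exists>A::complex set. open N \<and> open A \<and> q \<in> N \<and> q k \<in> A \<and> (\<forall>p\<in>N. \<forall>s\<in>A. p(k := s) \<in> V)"
    if "q \<in> V" for q :: "'a point" and k
  proof -
    have "open ((\<lambda>x::'a point \<times> complex. (fst x)(k := snd x)) -` V)"
      by (rule open_vimage[OF V upd])
    moreover have "(q, q k) \<in> (\<lambda>x. (fst x)(k := snd x)) -` V" using that by simp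
    ultimately obtain N A where "open N" "open A" "(q, q k) \<in> N \<times> A"
      "N \<times> A \<subseteq> (\<lambda>x. (fst x)(k := snd x)) -` V"
      by (rule open_prod_elim)
    then show ?thesis by (intro exI[of _ N] exI[of _ A]) auto
  qed
  have hol: "(\<lambda>s. f (p(k := s))) holomorphic_on A"
    if "open A" "\<And>s. s \<in> A \<Longrightarrow> p(k := s) \<in> V" for p k A
    unfolding holomorphic_on_def
  proof
    fix s assume "s \<in> A"
    then show "(\<lambda>s. f (p(k := s))) field_differentiable at s within A"
      using field_differentiable_at_within[OF holo_diff_at[OF f that(2)[of s], of k]] by simp
  qed
  have two: "(\<lambda>t. pd k f (q(l := t))) field_differentiable at (q l) \<and> pd l (pd k f) q = pd k (pd l f) q"
    if q: "q \<in> V" for q k l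
  proof (cases "k = l")
    case True
    obtain N A where NA: "open N" "open A" "q \<in> N" "q l \<in> A" "\<forall>p\<in>N. \<forall>s\<in>A. p(l := s) \<in> V"
      using box[OF q, of l] by (elim exE conjE) (rule that)
    have "(\<lambda>s. f (q(l := s))) holomorphic_on A" by (rule hol[OF NA(2)]) (use NA in auto)
    then have "deriv (\<lambda>s. f (q(l := s))) field_differentiable at (q l)"
      by (rule holomorphic_on_imp_differentiable_at[OF holomorphic_deriv[OF _ NA(2)] NA(2,4)])
    then show ?thesis using True by (simp add: pd_def)
  next
    case False
    have upd2: "continuous_on X (\<lambda>x::complex \<times> complex. q(k := fst x, l := snd x))" for X
      by (intro continuous_on_fun_upd continuous_on_const continuous_on_fst continuous_on_snd continuous_on_id)
    have "open ((\<lambda>x::complex \<times> complex. q(k := fst x, l := snd x)) -` V)"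
      by (rule open_vimage[OF V upd2])
    moreover have "(q k, q l) \<in> (\<lambda>x::complex \<times> complex. q(k := fst x, l := snd x)) -` V" using q by simp
    ultimately obtain A B where AB: "open A" "open B" "(q k, q l) \<in> A \<times> B"
      and sub: "A \<times> B \<subseteq> (\<lambda>x. q(k := fst x, l := snd x)) -` V"
      by (rule open_prod_elim)
    have inV: "q(k := s, l := t) \<in> V" if "s \<in> A" "t \<in> B" for s t
      using sub that by (auto simp: subset_iff)
    define g where "g = (\<lambda>s t. f (q(k := s, l := t)))"
    have "continuous_on (A \<times> B) (\<lambda>x. f (q(k := fst x, l := snd x)))"
      by (rule continuous_on_compose2[OF holo_continuous[OF f] upd2]) (auto intro!: inV)
    then have cont: "continuous_on (A \<times> B) (\<lambda>(s, t). g s t)"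
      by (simp add: g_def case_prod_unfold)
    have hol1: "(\<lambda>s. g s t) holomorphic_on A" if "t \<in> B" for t
      using hol[OF AB(1), of "q(l := t)" k] inV that False by (simp add: g_def fun_upd_twist)
    have hol2: "g s holomorphic_on B" if "s \<in> A" for s
      using hol[OF AB(2), of "q(k := s)" l] inV that by (simp add: g_def)
    have k: "pd k f (q(l := t)) = deriv (\<lambda>s. g s t) (q k)" for t
      using False by (simp add: pd_def g_def fun_upd_twist)
    have l: "pd l f (q(k := s)) = deriv (g s) (q l)" for s
      using False by (simp add: pd_def g_def)
    have "q k \<in> A" "q l \<in> B" using AB by auto
    note * = deriv_deriv_commute[where g = g, OF AB(1,2) cont _ _ this]
    have 1: "(\<lambda>t. deriv (\<lambda>s. g s t) (q k)) field_differentiable at (q l)"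
      by (rule *(1)) (use hol1 hol2 in auto)
    have 2: "deriv (\<lambda>t. deriv (\<lambda>s. g s t) (q k)) (q l) = deriv (\<lambda>s. deriv (g s) (q l)) (q k)"
      by (rule *(2)) (use hol1 hol2 in auto)
    show ?thesis
      using 1 2 by (simp add: k l pd_def[of l "pd k f"] pd_def[of k "pd l f"])
  qed
  then show "pd l (pd k f) q = pd k (pd l f) q" if "q \<in> V" using that by blast
  have local_cont: "\<exists>M. open M \<and> q \<in> M \<and> continuous_on M (pd k f)" if q: "q \<in> V" for q
  proof -
    obtain N A where NA: "open N" "open A" "q \<in> N" "q k \<in> A" and sub: "\<forall>p\<in>N. \<forall>s\<in>A. p(k := s) \<in> V"
      using box[OF q, of k] by (elim exE conjE) (rule that)
    define M where "M = N \<inter> (\<lambda>p. p k) -` A"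
    have "open M"
      unfolding M_def using NA
      by (intro open_Int open_vimage holo_continuous[OF holo_coord])
    have "q \<in> M" using NA by (simp add: M_def)
    have "continuous_on (N \<times> A) (\<lambda>x. f ((fst x)(k := snd x)))"
      by (rule continuous_on_compose2[OF holo_continuous[OF f] upd]) (use sub in auto)
    then have "continuous_on (N \<times> A) (\<lambda>(p, s). f (p(k := s)))" by (simp add: case_prod_unfold)
    then have c: "continuous_on (N \<times> A) (\<lambda>(p, s). deriv (\<lambda>s. f (p(k := s))) s)"
      by (rule continuous_on_deriv_param[OF NA(1,2)]) (use sub in \<open>auto intro!: hol NA(2)\<close>)
    have "continuous_on M (\<lambda>p. (\<lambda>(p, s). deriv (\<lambda>s. f (p(k := s))) s) (p, p k))"
      by (rule continuous_on_compose2[OF c])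
         (auto simp: M_def intro!: continuous_on_Pair continuous_on_id holo_continuous[OF holo_coord])
    then have "continuous_on M (pd k f)" by (simp add: pd_def[abs_def])
    then show ?thesis using \<open>open M\<close> \<open>q \<in> M\<close> by blast
  qed
  have "continuous_on (\<Union>{M. open M \<and> continuous_on M (pd k f)}) (pd k f)"
    by (rule continuous_on_open_Union) auto
  then have "continuous_on V (pd k f)"
    by (rule continuous_on_subset) (use local_cont in blast)
  moreover have "depends_on S V (pd k f)"
    unfolding depends_on_def
  proof (intro ballI impI)
    fix q q' assume q: "q \<in> V" "q' \<in> V" "\<forall>j\<in>S. q j = q' j"
    show "pd k f q = pd k f q'"
    proof (cases "k \<in> S")
      case True
      then have "q k = q' k" using q by blast
      have "\<forall>\<^sub>F s in nhds (q k). f (q(k := s)) = f (q'(k := s))"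
        using eventually_fun_upd_in_open[OF V q(1), of k]
          eventually_fun_upd_in_open[OF V q(2), of k, folded \<open>q k = q' k\<close>]
        by eventually_elim (rule holo_depends[OF f], use q in auto)
      then show ?thesis unfolding pd_def by (rule deriv_cong_ev) fact
    next
      case False
      then show ?thesis using pd_eq_0[OF V f] q by simp
    qed
  qed
  ultimately show "holo S V (pd k f)"
    using two f by (simp add: holo_def)
qed

section \<open>Total derivatives\<close>

lemma total_der_eq_sum:
  assumes "open V" "holo S V f" "q \<in> V"
  shows "total_der A i f q = (\<Sum>k\<in>S. field_coeff A i k q * pd k f q)"
  unfolding total_der_def
  by (rule sum.mono_neutral_left) (use holo_finite[OF assms(2)] pd_eq_0[OF assms] in auto)

lemma total_der_cong:
  assumes "open V" "q \<in> V" "\<And>p. p \<in> V \<Longrightarrow> f p = g p"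
  shows "total_der A i f q = total_der A i g q"
  unfolding total_der_def using pd_cong[OF assms] by simp

lemma total_der_const [simp]: "total_der A i (\<lambda>_. c) q = 0"
  by (simp add: total_der_def)

lemma total_der_coord: "total_der A i (\<lambda>q. q k) q = field_coeff A i k q"
  by (simp add: total_der_def pd_coord)

lemma total_der_du [simp]: "total_der A i (du ds) = du (i # ds)"
  by (rule ext) (simp add: du_def[abs_def] total_der_coord)

section \<open>Rules of differentiation at regular points\<close>

lemma open_nonzero: "open V \<Longrightarrow> holo S V h \<Longrightarrow> open (V \<inter> {q. h q \<noteq> 0})"
  using continuous_open_preimage[of V h "- {0}"] holo_continuous[of S V h]
  by (simp add: vimage_def open_Compl)

text \<open>The rules of differentiation are available at such points, whereas the value of a
  meromorphic function at a pole is arbitrary. By \<open>loc_mero_regular\<close> a meromorphic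
  function is regular at generic points.\<close>

definition regular_at :: "('v point \<Rightarrow> complex) \<Rightarrow> 'v point \<Rightarrow> bool" where
  "regular_at f q \<longleftrightarrow> (\<exists>S N. open N \<and> q \<in> N \<and> holo S N f)"

lemma regular_at2:
  assumes "regular_at f q" "regular_at g q"
  obtains S N where "open N" "q \<in> N" "holo S N f" "holo S N g"
proof -
  obtain S N S' N' where "open N" "q \<in> N" "holo S N f" "open N'" "q \<in> N'" "holo S' N' g"
    using assms unfolding regular_at_def by blast
  then show ?thesis
    by (intro that[of "N \<inter> N'" "S \<union> S'"]) (auto intro: holo_mono simp: holo_finite)
qed

lemma total_der_add:
  assumes "regular_at f q" "regular_at g q"
  shows "total_der A i (\<lambda>q. f q + g q) q = total_der A i f q + total_der A i g q"
proof -
  obtain S N where *: "open N" "q \<in> N" "holo S N f" "holo S N g" by (rule regular_at2[OF assms])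
  show ?thesis
    using * total_der_eq_sum[OF *(1) holo_add[OF *(3,4)] *(2)]
    by (simp add: total_der_eq_sum pd_add[OF *(3,4,2)] algebra_simps sum.distrib)
qed

lemma total_der_mult:
  assumes "regular_at f q" "regular_at g q"
  shows "total_der A i (\<lambda>q. f q * g q) q = f q * total_der A i g q + total_der A i f q * g q"
proof -
  obtain S N where *: "open N" "q \<in> N" "holo S N f" "holo S N g" by (rule regular_at2[OF assms])
  show ?thesis
    using * total_der_eq_sum[OF *(1) holo_mult[OF *(3,4)] *(2)]
    by (simp add: total_der_eq_sum pd_mult[OF *(3,4,2)] algebra_simps sum.distrib sum_distrib_left)
qed

lemma regular_at_const [simp]: "regular_at (\<lambda>_. c) q"
  unfolding regular_at_def by (intro exI[of _ "{}"] exI[of _ UNIV]) auto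

lemma regular_at_coord [simp]: "regular_at (\<lambda>q. q k) q"
  unfolding regular_at_def by (intro exI[of _ "{k}"] exI[of _ UNIV]) auto

lemma regular_at_du [simp]: "regular_at (du ds) q"
  by (simp add: du_def[abs_def])

lemma regular_at_add: "regular_at f q \<Longrightarrow> regular_at g q \<Longrightarrow> regular_at (\<lambda>q. f q + g q) q"
  by (erule (1) regular_at2) (unfold regular_at_def, blast intro: holo_add)

lemma regular_at_diff: "regular_at f q \<Longrightarrow> regular_at g q \<Longrightarrow> regular_at (\<lambda>q. f q - g q) q"
  by (erule (1) regular_at2) (unfold regular_at_def, blast intro: holo_diff)

lemma regular_at_mult: "regular_at f q \<Longrightarrow> regular_at g q \<Longrightarrow> regular_at (\<lambda>q. f q * g q) q"
  by (erule (1) regular_at2) (unfold regular_at_def, blast intro: holo_mult)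

lemma regular_at_sum: "(\<And>i. i \<in> I \<Longrightarrow> regular_at (f i) q) \<Longrightarrow> regular_at (\<lambda>q. \<Sum>i\<in>I. f i q) q"
  by (induction I rule: infinite_finite_induct) (auto intro: regular_at_add)

lemma total_der_sum:
  "(\<And>i. i \<in> I \<Longrightarrow> regular_at (f i) q) \<Longrightarrow>
    total_der A j (\<lambda>q. \<Sum>i\<in>I. f i q) q = (\<Sum>i\<in>I. total_der A j (f i) q)"
  by (induction I rule: infinite_finite_induct) (auto simp: total_der_add regular_at_sum)

lemma total_der_diff:
  assumes "regular_at f q" "regular_at g q"
  shows "total_der A i (\<lambda>q. f q - g q) q = total_der A i f q - total_der A i g q"
proof -
  have m: "regular_at (\<lambda>q. (-1) * g q) q" by (intro regular_at_mult assms regular_at_const)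
  have "total_der A i (\<lambda>q. f q + (-1) * g q) q = total_der A i f q - total_der A i g q"
    by (subst total_der_add[OF assms(1) m], subst total_der_mult[OF regular_at_const assms(2)]) simp
  then show ?thesis by simp
qed

lemma regular_at_nonzero:
  assumes "regular_at g q" "g q \<noteq> 0"
  obtains S N where "open N" "q \<in> N" "holo S N g" "\<And>p. p \<in> N \<Longrightarrow> g p \<noteq> 0"
proof -
  obtain S N where *: "open N" "q \<in> N" "holo S N g" using assms(1) unfolding regular_at_def by blast
  show ?thesis
    by (rule that[OF open_nonzero[OF *(1,3)] _ holo_mono[OF *(3)]]) (use * assms(2) holo_finite in auto)
qed

lemma regular_at_divide:
  assumes "regular_at f q" "regular_at g q" "g q \<noteq> 0"
  shows "regular_at (\<lambda>q. f q / g q) q"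
proof -
  obtain S N where N: "open N" "q \<in> N" "holo S N g" "\<And>p. p \<in> N \<Longrightarrow> g p \<noteq> 0"
    by (rule regular_at_nonzero[OF assms(2,3)]) (rule that)
  have "holo S N (\<lambda>q. 1 / g q)"
    by (rule holo_divide[OF holo_const' N(3,4)]) (use holo_finite[OF N(3)] in auto)
  then have "regular_at (\<lambda>q. 1 / g q) q" using N unfolding regular_at_def by blast
  from regular_at_mult[OF assms(1) this] show ?thesis by simp
qed

lemma total_der_divide:
  assumes "regular_at f q" "regular_at g q" "g q \<noteq> 0"
  shows "total_der A i (\<lambda>q. f q / g q) q = (total_der A i f q * g q - f q * total_der A i g q) / (g q * g q)"
proof -
  obtain S N where N: "open N" "q \<in> N" "holo S N g" "\<And>p. p \<in> N \<Longrightarrow> g p \<noteq> 0"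
    by (rule regular_at_nonzero[OF assms(2,3)]) (rule that)
  have "total_der A i f q = total_der A i (\<lambda>q. f q / g q * g q) q"
    by (rule total_der_cong[OF N(1,2)]) (simp add: N(4))
  also have "\<dots> = f q / g q * total_der A i g q + total_der A i (\<lambda>q. f q / g q) q * g q"
    by (rule total_der_mult[OF regular_at_divide[OF assms] assms(2)])
  finally show ?thesis using assms(3) by (simp add: field_simps)
qed

lemmas total_der_rules = total_der_add total_der_diff total_der_mult total_der_divide
  regular_at_add regular_at_diff regular_at_mult regular_at_divide

text \<open>In an iterated total derivative of \<open>f\<close> the second partial derivatives form
  a double sum that is symmetric in \<open>i\<close> and \<open>j\<close> by
  \<open>pd_commute\<close>, so they cancel. What remains are the commutators on the coordinates
  themselves.\<close>

lemma total_der_commutator: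
  assumes N: "open N" "q \<in> N" and f: "holo S N f"
    and A: "\<And>i v. Nonloc v \<in> S \<Longrightarrow> regular_at (A i v) q"
  shows "total_der A i (total_der A j f) q - total_der A j (total_der A i f) q =
    (\<Sum>k\<in>S. (total_der A i (field_coeff A j k) q - total_der A j (field_coeff A i k) q) * pd k f q)"
proof -
  have coeff: "regular_at (field_coeff A i k) q" if "k \<in> S" for i k
  proof (cases k)
    case (Indep d) then show ?thesis by (simp add: field_coeff.simps[abs_def])
  next
    case (Jet x) then show ?thesis by (simp add: field_coeff.simps[abs_def])
  next
    case (Nonloc x) then show ?thesis using A that by (simp add: field_coeff.simps[abs_def])
  qed
  have pd: "regular_at (pd k f) q" for k
    unfolding regular_at_def using N holo_pd[OF N(1) f] by blast
  have *: "total_der A i (total_der A j f) q =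
    (\<Sum>k\<in>S. total_der A i (field_coeff A j k) q * pd k f q) +
    (\<Sum>k\<in>S. \<Sum>l\<in>S. field_coeff A j k q * field_coeff A i l q * pd l (pd k f) q)" for i j
  proof -
    have "total_der A i (total_der A j f) q = total_der A i (\<lambda>q. \<Sum>k\<in>S. field_coeff A j k q * pd k f q) q"
      by (rule total_der_cong[OF N]) (rule total_der_eq_sum[OF N(1) f])
    also have "\<dots> = (\<Sum>k\<in>S. total_der A i (\<lambda>q. field_coeff A j k q * pd k f q) q)"
      by (rule total_der_sum) (intro regular_at_mult coeff pd)
    also have "\<dots> = (\<Sum>k\<in>S. field_coeff A j k q * total_der A i (pd k f) q + total_der A i (field_coeff A j k) q * pd k f q)"
      by (rule sum.cong[OF refl]) (rule total_der_mult[OF coeff pd])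
    also have "\<dots> = (\<Sum>k\<in>S. field_coeff A j k q * (\<Sum>l\<in>S. field_coeff A i l q * pd l (pd k f) q)
        + total_der A i (field_coeff A j k) q * pd k f q)"
      using total_der_eq_sum[OF N(1) holo_pd[OF N(1) f] N(2)] by simp
    finally show ?thesis by (simp add: sum.distrib sum_distrib_left mult.assoc)
  qed
  have "(\<Sum>k\<in>S. \<Sum>l\<in>S. field_coeff A j k q * field_coeff A i l q * pd l (pd k f) q) =
        (\<Sum>k\<in>S. \<Sum>l\<in>S. field_coeff A i k q * field_coeff A j l q * pd l (pd k f) q)"
    by (subst sum.swap) (simp add: pd_commute[OF N(1) f N(2)] mult.commute)
  then show ?thesis
    by (simp add: * sum_subtractf left_diff_distrib)
qed

lemma total_der_field_coeff_commute:
  assumes "\<And>v. k \<noteq> Nonloc v"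
  shows "total_der A i (field_coeff A j k) q = total_der A j (field_coeff A i k) q"
proof (cases k)
  case (Indep d)
  then show ?thesis by (simp add: field_coeff.simps[abs_def])
next
  case (Jet x)
  then show ?thesis by (simp add: field_coeff.simps[abs_def] total_der_coord add_mset_commute)
qed (use assms in auto)

section \<open>Generic points, meromorphic functions and the ideal of the equation\<close>

lemma denominator_const: "c \<noteq> 0 \<Longrightarrow> denominator F V (\<lambda>_. c)"
  unfolding denominator_def by (auto intro!: exI[of _ "{}"])

lemma denominator_subset: "denominator F V h \<Longrightarrow> V' \<subseteq> V \<Longrightarrow> denominator F V' h"
  unfolding denominator_def by (meson holo_finite holo_mono subset_refl subset_trans)

text \<open>The condition on \<open>k\<close> is applied to the part of \<open>W\<close> where
  \<open>h\<close> is nonzero; this part is open and still meets the manifold by the condition on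
  \<open>h\<close>.\<close>

lemma denominator_mult:
  assumes V: "open V" and h: "denominator F V h" "denominator F V k"
  shows "denominator F V (\<lambda>q. h q * k q)"
proof -
  obtain S T where S: "holo S V h" and T: "holo T V k"
    using h unfolding denominator_def by auto
  have "holo (S \<union> T) V (\<lambda>q. h q * k q)"
    using S T by (intro holo_mult) (auto intro: holo_mono simp: holo_finite)
  moreover have "\<exists>q\<in>W \<inter> eqn_manifold F. h q * k q \<noteq> 0"
    if W: "open W" "W \<subseteq> V" "W \<inter> eqn_manifold F \<noteq> {}" for W
  proof -
    have "W \<inter> {q. h q \<noteq> 0} \<inter> eqn_manifold F \<noteq> {}"
      using h(1) W unfolding denominator_def by blast
    moreover have "open (W \<inter> {q. h q \<noteq> 0})"
      by (rule open_nonzero[OF W(1) holo_mono[OF S]]) (use W S holo_finite in auto)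
    ultimately obtain q where "q \<in> W \<inter> {q. h q \<noteq> 0} \<inter> eqn_manifold F" "k q \<noteq> 0"
      using h(2) W(2) unfolding denominator_def by (metis inf.coboundedI1)
    then show ?thesis by auto
  qed
  ultimately show ?thesis unfolding denominator_def by blast
qed

text \<open>
  The set \<open>S\<close> is kept explicit because \<open>loc_mero\<close> asks for one set of coordinates that serves
  all points.
\<close>

definition generic_at ::
  "('v point \<Rightarrow> complex) \<Rightarrow> 'v coord set \<Rightarrow> 'v point \<Rightarrow> ('v point \<Rightarrow> bool) \<Rightarrow> bool" where
  "generic_at F S p P \<longleftrightarrow>
     (\<exists>V h. open V \<and> p \<in> V \<and> holo S V h \<and> denominator F V h \<and> (\<forall>q\<in>V. h q \<noteq> 0 \<longrightarrow> P q))"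

definition generically ::
  "('v point \<Rightarrow> complex) \<Rightarrow> 'v point set \<Rightarrow> ('v point \<Rightarrow> bool) \<Rightarrow> bool" where
  "generically F \<Omega> P \<longleftrightarrow> (\<exists>S. finite S \<and> (\<forall>p \<in> \<Omega> \<inter> eqn_manifold F. generic_at F S p P))"

definition fraction_at ::
  "('v point \<Rightarrow> complex) \<Rightarrow> 'v coord set \<Rightarrow> 'v point \<Rightarrow> ('v point \<Rightarrow> complex) \<Rightarrow> bool" where
  "fraction_at F S p f \<longleftrightarrow>
     (\<exists>V g h. open V \<and> p \<in> V \<and> holo S V g \<and> holo S V h \<and> denominator F V h \<and>
       (\<forall>q\<in>V. h q \<noteq> 0 \<longrightarrow> f q = g q / h q))"

lemma loc_mero_iff:
  "loc_mero F \<Omega> f \<longleftrightarrow> (\<exists>S. finite S \<and> (\<forall>p \<in> \<Omega> \<inter> eqn_manifold F. fraction_at F S p f))"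
  unfolding loc_mero_def fraction_at_def ..

lemma generic_atI:
  "open V \<Longrightarrow> p \<in> V \<Longrightarrow> holo S V h \<Longrightarrow> denominator F V h \<Longrightarrow> (\<And>q. q \<in> V \<Longrightarrow> h q \<noteq> 0 \<Longrightarrow> P q)
    \<Longrightarrow> generic_at F S p P"
  unfolding generic_at_def by (intro exI[of _ V] exI[of _ h]) simp

lemma generic_atE:
  assumes "generic_at F S p P"
  obtains V h where "open V" "p \<in> V" "holo S V h" "denominator F V h" "\<And>q. q \<in> V \<Longrightarrow> h q \<noteq> 0 \<Longrightarrow> P q"
  using assms unfolding generic_at_def by auto

lemma fraction_atI:
  "open V \<Longrightarrow> p \<in> V \<Longrightarrow> holo S V g \<Longrightarrow> holo S V h \<Longrightarrow> denominator F V h \<Longrightarrow>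
    (\<And>q. q \<in> V \<Longrightarrow> h q \<noteq> 0 \<Longrightarrow> f q = g q / h q) \<Longrightarrow> fraction_at F S p f"
  unfolding fraction_at_def by (intro exI[of _ V] exI[of _ g] exI[of _ h]) simp

lemma fraction_atE:
  assumes "fraction_at F S p f"
  obtains V g h where "open V" "p \<in> V" "holo S V g" "holo S V h" "denominator F V h"
    "\<And>q. q \<in> V \<Longrightarrow> h q \<noteq> 0 \<Longrightarrow> f q = g q / h q"
  using assms unfolding fraction_at_def by auto

lemma generic_at_mono:
  assumes "generic_at F S p P" "S \<subseteq> T" "finite T" "\<And>q. P q \<Longrightarrow> Q q"
  shows "generic_at F T p Q"
proof -
  obtain V h where *: "open V" "p \<in> V" "holo S V h" "denominator F V h" "\<And>q. q \<in> V \<Longrightarrow> h q \<noteq> 0 \<Longrightarrow> P q"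
    using assms(1) by (rule generic_atE) (rule that)
  show ?thesis
    by (rule generic_atI[OF *(1,2) holo_mono[OF *(3)] *(4)]) (use assms * in auto)
qed

lemma generic_at_conj:
  assumes "generic_at F S p P" "generic_at F S p Q"
  shows "generic_at F S p (\<lambda>q. P q \<and> Q q)"
proof -
  obtain V h where V: "open V" "p \<in> V" "holo S V h" "denominator F V h" "\<And>q. q \<in> V \<Longrightarrow> h q \<noteq> 0 \<Longrightarrow> P q"
    using assms(1) by (rule generic_atE) (rule that)
  obtain W k where W: "open W" "p \<in> W" "holo S W k" "denominator F W k" "\<And>q. q \<in> W \<Longrightarrow> k q \<noteq> 0 \<Longrightarrow> Q q"
    using assms(2) by (rule generic_atE) (rule that)
  have S: "finite S" using V(3) by (rule holo_finite)
  have o: "open (V \<inter> W)" using V W by auto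
  show ?thesis
    by (rule generic_atI[OF o _ holo_mult denominator_mult[OF o], of p S h k])
       (use V W S in \<open>auto intro: holo_mono denominator_subset\<close>)
qed

lemma fraction_at_mono:
  assumes "fraction_at F S p f" "S \<subseteq> T" "finite T"
  shows "fraction_at F T p f"
proof -
  obtain V g h where *: "open V" "p \<in> V" "holo S V g" "holo S V h" "denominator F V h"
    "\<And>q. q \<in> V \<Longrightarrow> h q \<noteq> 0 \<Longrightarrow> f q = g q / h q"
    using assms(1) by (rule fraction_atE) (rule that)
  show ?thesis
    by (rule fraction_atI[OF *(1,2) holo_mono[OF *(3)] holo_mono[OF *(4)] *(5,6)]) (use assms in auto)
qed

lemma fraction_at_cong:
  assumes "fraction_at F S p f" "generic_at F S p (\<lambda>q. g q = f q)"
  shows "fraction_at F S p g"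
proof -
  obtain V a h where V: "open V" "p \<in> V" "holo S V a" "holo S V h" "denominator F V h"
    "\<And>q. q \<in> V \<Longrightarrow> h q \<noteq> 0 \<Longrightarrow> f q = a q / h q"
    using assms(1) by (rule fraction_atE) (rule that)
  obtain W k where W: "open W" "p \<in> W" "holo S W k" "denominator F W k" "\<And>q. q \<in> W \<Longrightarrow> k q \<noteq> 0 \<Longrightarrow> g q = f q"
    using assms(2) by (rule generic_atE) (rule that)
  have S: "finite S" using V(3) by (rule holo_finite)
  have o: "open (V \<inter> W)" using V W by auto
  have h: "holo S (V \<inter> W) a" "holo S (V \<inter> W) h" "holo S (V \<inter> W) k"
    using V W S by (auto intro: holo_mono)
  show ?thesis
    by (rule fraction_atI[OF o _ holo_mult[OF h(1,3)] holo_mult[OF h(2,3)] denominator_mult[OF o]])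
       (use V W S in \<open>auto intro: denominator_subset\<close>)
qed

lemma fraction_at_common_denominator:
  assumes "fraction_at F S p f" "fraction_at F S p g"
  obtains V a b h where "open V" "p \<in> V" "holo S V a" "holo S V b" "holo S V h" "denominator F V h"
    "\<And>q. q \<in> V \<Longrightarrow> h q \<noteq> 0 \<Longrightarrow> f q = a q / h q" "\<And>q. q \<in> V \<Longrightarrow> h q \<noteq> 0 \<Longrightarrow> g q = b q / h q"
proof -
  obtain V a h where V: "open V" "p \<in> V" "holo S V a" "holo S V h" "denominator F V h"
    "\<And>q. q \<in> V \<Longrightarrow> h q \<noteq> 0 \<Longrightarrow> f q = a q / h q"
    using assms(1) by (rule fraction_atE) (rule that)
  obtain W b k where W: "open W" "p \<in> W" "holo S W b" "holo S W k" "denominator F W k"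
    "\<And>q. q \<in> W \<Longrightarrow> k q \<noteq> 0 \<Longrightarrow> g q = b q / k q"
    using assms(2) by (rule fraction_atE) (rule that)
  have S: "finite S" using V(3) by (rule holo_finite)
  have o: "open (V \<inter> W)" using V W by auto
  have h: "holo S (V \<inter> W) a" "holo S (V \<inter> W) h" "holo S (V \<inter> W) b" "holo S (V \<inter> W) k"
    using V W S by (auto intro: holo_mono)
  show ?thesis
    by (rule that[OF o _ holo_mult[OF h(1,4)] holo_mult[OF h(2,3)] holo_mult[OF h(2,4)] denominator_mult[OF o]])
       (use V W S in \<open>auto intro: denominator_subset\<close>)
qed

lemma fraction_at_add:
  assumes "fraction_at F S p f" "fraction_at F S p g"
  shows "fraction_at F S p (\<lambda>q. f q + g q)"
proof -
  obtain V a b h where *: "open V" "p \<in> V" "holo S V a" "holo S V b" "holo S V h" "denominator F V h"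
    "\<And>q. q \<in> V \<Longrightarrow> h q \<noteq> 0 \<Longrightarrow> f q = a q / h q" "\<And>q. q \<in> V \<Longrightarrow> h q \<noteq> 0 \<Longrightarrow> g q = b q / h q"
    by (rule fraction_at_common_denominator[OF assms]) (rule that)
  show ?thesis
    by (rule fraction_atI[OF *(1,2) holo_add[OF *(3,4)] *(5,6)]) (simp add: *(7,8) add_divide_distrib)
qed

lemma fraction_at_mult:
  assumes "fraction_at F S p f" "fraction_at F S p g"
  shows "fraction_at F S p (\<lambda>q. f q * g q)"
proof -
  obtain V a b h where *: "open V" "p \<in> V" "holo S V a" "holo S V b" "holo S V h" "denominator F V h"
    "\<And>q. q \<in> V \<Longrightarrow> h q \<noteq> 0 \<Longrightarrow> f q = a q / h q" "\<And>q. q \<in> V \<Longrightarrow> h q \<noteq> 0 \<Longrightarrow> g q = b q / h q"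
    by (rule fraction_at_common_denominator[OF assms]) (rule that)
  show ?thesis
    by (rule fraction_atI[OF *(1,2) holo_mult[OF *(3,4)] holo_mult[OF *(5,5)] denominator_mult[OF *(1,6,6)]])
       (simp add: *(7,8))
qed

lemma fraction_at_pd:
  assumes "fraction_at F S p f"
  shows "fraction_at F S p (pd k f)"
proof -
  obtain V g h where *: "open V" "p \<in> V" "holo S V g" "holo S V h" "denominator F V h"
    "\<And>q. q \<in> V \<Longrightarrow> h q \<noteq> 0 \<Longrightarrow> f q = g q / h q"
    using assms(1) by (rule fraction_atE) (rule that)
  have "pd k f q = (pd k g q * h q - g q * pd k h q) / (h q * h q)" if "q \<in> V" "h q \<noteq> 0" for q
  proof -
    have "pd k f q = pd k (\<lambda>q. g q / h q) q"
      by (rule pd_cong[OF open_nonzero[OF *(1,4)]]) (use that *(6) in auto)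
    also have "\<dots> = (pd k g q * h q - g q * pd k h q) / (h q * h q)"
      by (rule pd_divide[OF *(3,4) that])
    finally show ?thesis .
  qed
  then show ?thesis
    by (rule fraction_atI[OF *(1,2) holo_diff[OF holo_mult[OF holo_pd[OF *(1,3)] *(4)] holo_mult[OF *(3) holo_pd[OF *(1,4)]]]
          holo_mult[OF *(4,4)] denominator_mult[OF *(1,5,5)]]) simp_all
qed

section \<open>Calculus of generic identities\<close>

lemma generically_mono: "generically F \<Omega> P \<Longrightarrow> (\<And>q. P q \<Longrightarrow> Q q) \<Longrightarrow> generically F \<Omega> Q"
  unfolding generically_def using generic_at_mono[of F _ _ P _ Q] by (metis order_refl)

lemma generically_conj:
  assumes "generically F \<Omega> P" "generically F \<Omega> Q"
  shows "generically F \<Omega> (\<lambda>q. P q \<and> Q q)"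
proof -
  obtain S T where ST: "finite S" "finite T" "\<And>p. p \<in> \<Omega> \<inter> eqn_manifold F \<Longrightarrow> generic_at F S p P"
    "\<And>p. p \<in> \<Omega> \<inter> eqn_manifold F \<Longrightarrow> generic_at F T p Q"
    using assms unfolding generically_def by auto
  show ?thesis unfolding generically_def
    by (intro exI[of _ "S \<union> T"] conjI ballI generic_at_conj)
       (use ST in \<open>auto intro: generic_at_mono\<close>)
qed

lemma generically_True: "(\<And>q. P q) \<Longrightarrow> generically F \<Omega> P"
  unfolding generically_def
  by (intro exI[of _ "{}"] conjI ballI generic_atI[of UNIV _ _ "\<lambda>_. 1"] denominator_const) auto

lemma generically_ball:
  "finite I \<Longrightarrow> (\<And>i. i \<in> I \<Longrightarrow> generically F \<Omega> (P i)) \<Longrightarrow> generically F \<Omega> (\<lambda>q. \<forall>i\<in>I. P i q)"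
  by (induction I rule: finite_induct) (auto intro: generically_True generically_conj)

lemma generically_member: "open \<Omega> \<Longrightarrow> generically F \<Omega> (\<lambda>q. q \<in> \<Omega>)"
  unfolding generically_def
  by (intro exI[of _ "{}"] conjI ballI generic_atI[of \<Omega> _ _ "\<lambda>_. 1"] denominator_const) auto

text \<open>A denominator that is nonzero at a point is nonzero nearby. Hence a generic identity
  holds on open sets and may be differentiated, as in \<open>generically_total_der\<close>.\<close>

lemma generically_neighbourhood:
  assumes "generically F \<Omega> P"
  shows "generically F \<Omega> (\<lambda>q. \<exists>N. open N \<and> q \<in> N \<and> (\<forall>p\<in>N. P p))"
proof -
  obtain S where S: "finite S" "\<And>p. p \<in> \<Omega> \<inter> eqn_manifold F \<Longrightarrow> generic_at F S p P"
    using assms unfolding generically_def by auto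
  have "generic_at F S p (\<lambda>q. \<exists>N. open N \<and> q \<in> N \<and> (\<forall>p\<in>N. P p))" if gen: "generic_at F S p P" for p
  proof -
    obtain V h where *: "open V" "p \<in> V" "holo S V h" "denominator F V h" "\<And>q. q \<in> V \<Longrightarrow> h q \<noteq> 0 \<Longrightarrow> P q"
      using gen by (rule generic_atE) (rule that)
    have "\<exists>N. open N \<and> q \<in> N \<and> (\<forall>p\<in>N. P p)" if "q \<in> V" "h q \<noteq> 0" for q
      by (intro exI[of _ "V \<inter> {q. h q \<noteq> 0}"] conjI open_nonzero[OF *(1,3)]) (use *(5) that in auto)
    then show ?thesis by (rule generic_atI[OF *(1-4)])
  qed
  then show ?thesis using S unfolding generically_def by blast
qed

lemma generically_total_der:
  assumes "generically F \<Omega> (\<lambda>q. f q = g q)"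
  shows "generically F \<Omega> (\<lambda>q. total_der A i f q = total_der A i g q)"
  by (rule generically_mono[OF generically_neighbourhood[OF assms]]) (auto intro: total_der_cong)

section \<open>Locally meromorphic functions\<close>

lemma loc_mero_cong:
  assumes "loc_mero F \<Omega> f" "generically F \<Omega> (\<lambda>q. g q = f q)"
  shows "loc_mero F \<Omega> g"
proof -
  obtain S T where ST: "finite S" "finite T" "\<And>p. p \<in> \<Omega> \<inter> eqn_manifold F \<Longrightarrow> fraction_at F S p f"
    "\<And>p. p \<in> \<Omega> \<inter> eqn_manifold F \<Longrightarrow> generic_at F T p (\<lambda>q. g q = f q)"
    using assms unfolding generically_def loc_mero_iff by auto
  show ?thesis unfolding loc_mero_iff
    by (intro exI[of _ "S \<union> T"] conjI ballI fraction_at_cong[of F _ _ f g])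
       (use ST in \<open>auto intro: fraction_at_mono generic_at_mono\<close>)
qed

lemma loc_mero_subset: "loc_mero F \<Omega> f \<Longrightarrow> \<Omega>' \<subseteq> \<Omega> \<Longrightarrow> loc_mero F \<Omega>' f"
  unfolding loc_mero_iff by (meson IntD1 IntD2 IntI subsetD)

lemma loc_mero_holo_on: "open \<Omega> \<Longrightarrow> holo S \<Omega> f \<Longrightarrow> loc_mero F \<Omega> f"
  unfolding loc_mero_iff
  by (intro exI[of _ S] conjI ballI fraction_atI[of \<Omega> _ S f "\<lambda>_. 1"] denominator_const)
     (auto intro: holo_finite holo_const')

lemma loc_mero_holo: "holo S UNIV f \<Longrightarrow> loc_mero F \<Omega> f"
  using loc_mero_subset[OF loc_mero_holo_on[OF open_UNIV]] by blast

lemma loc_mero_const [simp]: "loc_mero F \<Omega> (\<lambda>_. c)"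
  by (rule loc_mero_holo[OF holo_const])

lemma loc_mero_coord [simp]: "loc_mero F \<Omega> (\<lambda>q. q k)"
  by (rule loc_mero_holo[OF holo_coord])

lemma loc_mero_du [simp]: "loc_mero F \<Omega> (du ds)"
  by (simp add: du_def[abs_def])

lemma
  assumes "loc_mero F \<Omega> f" "loc_mero F \<Omega> g"
  shows loc_mero_add: "loc_mero F \<Omega> (\<lambda>q. f q + g q)"
    and loc_mero_mult: "loc_mero F \<Omega> (\<lambda>q. f q * g q)"
proof -
  obtain S T where ST: "finite S" "finite T" "\<And>p. p \<in> \<Omega> \<inter> eqn_manifold F \<Longrightarrow> fraction_at F S p f"
    "\<And>p. p \<in> \<Omega> \<inter> eqn_manifold F \<Longrightarrow> fraction_at F T p g"
    using assms unfolding generically_def loc_mero_iff by auto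
  show "loc_mero F \<Omega> (\<lambda>q. f q + g q)" unfolding loc_mero_iff
    by (intro exI[of _ "S \<union> T"] conjI ballI fraction_at_add)
       (use ST in \<open>auto intro: fraction_at_mono\<close>)
  show "loc_mero F \<Omega> (\<lambda>q. f q * g q)" unfolding loc_mero_iff
    by (intro exI[of _ "S \<union> T"] conjI ballI fraction_at_mult)
       (use ST in \<open>auto intro: fraction_at_mono\<close>)
qed

lemma loc_mero_minus: "loc_mero F \<Omega> f \<Longrightarrow> loc_mero F \<Omega> (\<lambda>q. - f q)"
  using loc_mero_mult[of F \<Omega> "\<lambda>_. -1" f] by simp

lemma loc_mero_diff: "loc_mero F \<Omega> f \<Longrightarrow> loc_mero F \<Omega> g \<Longrightarrow> loc_mero F \<Omega> (\<lambda>q. f q - g q)"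
  using loc_mero_add[of F \<Omega> f "\<lambda>q. - g q"] loc_mero_minus[of F \<Omega> g] by simp

lemma loc_mero_sum:
  "(\<And>i. i \<in> I \<Longrightarrow> loc_mero F \<Omega> (f i)) \<Longrightarrow> loc_mero F \<Omega> (\<lambda>q. \<Sum>i\<in>I. f i q)"
  by (induction I rule: infinite_finite_induct) (auto intro: loc_mero_add)

lemma loc_mero_divide:
  assumes "loc_mero F \<Omega> f" "open \<Omega>" "holo S \<Omega> h" "\<And>q. q \<in> \<Omega> \<Longrightarrow> h q \<noteq> 0"
  shows "loc_mero F \<Omega> (\<lambda>q. f q / h q)"
proof -
  have "loc_mero F \<Omega> (\<lambda>q. 1 / h q)"
    by (rule loc_mero_holo_on[OF assms(2) holo_divide[OF holo_const' assms(3,4)]])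
       (use assms holo_finite in auto)
  from loc_mero_mult[OF assms(1) this] show ?thesis by simp
qed

lemma loc_mero_pd: "loc_mero F \<Omega> f \<Longrightarrow> loc_mero F \<Omega> (pd k f)"
  unfolding loc_mero_iff using fraction_at_pd by meson

text \<open>A coordinate set common to all generic points makes a total derivative of
  \<open>f\<close> generically one fixed finite sum. This is how \<open>loc_mero_D\<close> and
  \<open>vanishes_D_commutator\<close> use it.\<close>

lemma loc_mero_generic_holo:
  assumes "loc_mero F \<Omega> f"
  obtains S where "finite S" "generically F \<Omega> (\<lambda>q. \<exists>N. open N \<and> q \<in> N \<and> holo S N f)"
proof -
  obtain S where S: "finite S" "\<And>p. p \<in> \<Omega> \<inter> eqn_manifold F \<Longrightarrow> fraction_at F S p f"
    using assms unfolding loc_mero_iff by auto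
  have "generic_at F S p (\<lambda>q. \<exists>N. open N \<and> q \<in> N \<and> holo S N f)" if frac: "fraction_at F S p f" for p
  proof -
    obtain V g h where *: "open V" "p \<in> V" "holo S V g" "holo S V h" "denominator F V h"
      "\<And>q. q \<in> V \<Longrightarrow> h q \<noteq> 0 \<Longrightarrow> f q = g q / h q"
      using frac by (rule fraction_atE) (rule that)
    let ?N = "V \<inter> {q. h q \<noteq> 0}"
    have o: "open ?N" by (rule open_nonzero[OF *(1,4)])
    have "holo S ?N (\<lambda>q. g q / h q)"
      by (rule holo_divide) (use *(3,4) S in \<open>auto intro: holo_mono\<close>)
    then have "holo S ?N f"
      by (rule holo_cong[OF o, rotated]) (use *(6) in auto)
    then show ?thesis
      by (intro generic_atI[OF *(1,2,4,5)] exI[of _ ?N] conjI o) auto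
  qed
  then have "generically F \<Omega> (\<lambda>q. \<exists>N. open N \<and> q \<in> N \<and> holo S N f)"
    using S unfolding generically_def by blast
  then show ?thesis using that S by blast
qed

lemma loc_mero_regular:
  assumes "loc_mero F \<Omega> f"
  shows "generically F \<Omega> (regular_at f)"
proof -
  obtain S where "generically F \<Omega> (\<lambda>q. \<exists>N. open N \<and> q \<in> N \<and> holo S N f)"
    using assms by (rule loc_mero_generic_holo)
  then show ?thesis by (rule generically_mono) (auto simp: regular_at_def)
qed

subsection \<open>The ideal\<close>

text \<open>Lets closure under \<open>D\<close> be proved at one point at a time, where a single
  finite family of consequences and coefficients suffices.\<close>

lemma vanishes_pointwise: "vanishes F \<Omega> f \<longleftrightarrow> (\<forall>p\<in>\<Omega>. vanishes F {p} f)"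
  unfolding vanishes_def by auto

lemma vanishes_subset: "vanishes F \<Omega> f \<Longrightarrow> \<Omega>' \<subseteq> \<Omega> \<Longrightarrow> vanishes F \<Omega>' f"
  unfolding vanishes_def by auto

text \<open>A uniform form of the condition in \<open>vanishes\<close> at one point: a common
  coordinate set for the denominator and all coefficients, and coefficients that are holomorphic
  even outside \<open>L\<close>. This makes sums and products of representations easy to
  form.\<close>

definition ideal_at :: "('v point \<Rightarrow> complex) \<Rightarrow> 'v point \<Rightarrow> ('v point \<Rightarrow> complex) \<Rightarrow> bool" where
  "ideal_at F p f \<longleftrightarrow> (\<exists>V h L r S.
     open V \<and> p \<in> V \<and> holo S V h \<and> denominator F V h \<and> finite L \<and> (\<forall>ds. holo S V (r ds)) \<and>
     (\<forall>q\<in>V. h q \<noteq> 0 \<longrightarrow> f q = (\<Sum>ds\<in>L. r ds q * consequence F ds q) / h q))"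

lemma ideal_atI:
  "open V \<Longrightarrow> p \<in> V \<Longrightarrow> holo S V h \<Longrightarrow> denominator F V h \<Longrightarrow> finite L \<Longrightarrow> (\<And>ds. holo S V (r ds)) \<Longrightarrow>
     (\<And>q. q \<in> V \<Longrightarrow> h q \<noteq> 0 \<Longrightarrow> f q = (\<Sum>ds\<in>L. r ds q * consequence F ds q) / h q) \<Longrightarrow> ideal_at F p f"
  unfolding ideal_at_def by (intro exI[of _ V] exI[of _ h] exI[of _ L] exI[of _ r] exI[of _ S]) simp

lemma ideal_atE:
  assumes "ideal_at F p f"
  obtains V h L r S where "open V" "p \<in> V" "holo S V h" "denominator F V h" "finite L" "\<And>ds. holo S V (r ds)"
     "\<And>q. q \<in> V \<Longrightarrow> h q \<noteq> 0 \<Longrightarrow> f q = (\<Sum>ds\<in>L. r ds q * consequence F ds q) / h q"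
proof -
  obtain V h L r S where "open V \<and> p \<in> V \<and> holo S V h \<and> denominator F V h \<and> finite L \<and> (\<forall>ds. holo S V (r ds)) \<and>
     (\<forall>q\<in>V. h q \<noteq> 0 \<longrightarrow> f q = (\<Sum>ds\<in>L. r ds q * consequence F ds q) / h q)"
    using assms unfolding ideal_at_def by (elim exE) (rule that)
  then show ?thesis by (intro that[of V S h L r]) auto
qed

lemma vanishes_iff_ideal_at: "vanishes F \<Omega> f \<longleftrightarrow> (\<forall>p\<in>\<Omega> \<inter> eqn_manifold F. ideal_at F p f)"
proof
  assume v: "vanishes F \<Omega> f"
  show "\<forall>p\<in>\<Omega> \<inter> eqn_manifold F. ideal_at F p f"
  proof
    fix p assume "p \<in> \<Omega> \<inter> eqn_manifold F"
    note v = bspec[OF v[unfolded vanishes_def] this]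
    obtain V h L r where *: "open V" "p \<in> V" "denominator F V h" "finite L" "\<forall>ds\<in>L. \<exists>S. holo S V (r ds)"
     "\<forall>q\<in>V. h q \<noteq> 0 \<longrightarrow> f q = (\<Sum>ds\<in>L. r ds q * consequence F ds q) / h q"
      using v by (elim exE conjE) (rule that; assumption)
    obtain S where S: "\<And>ds. ds \<in> L \<Longrightarrow> holo (S ds) V (r ds)" using *(5) by metis
    obtain T where T: "holo T V h" using *(3) unfolding denominator_def by auto
    define R where "R = T \<union> (\<Union>ds\<in>L. S ds)"
    define r' where "r' = (\<lambda>ds. if ds \<in> L then r ds else (\<lambda>_. 0))"
    have R: "finite R" using S T *(4) holo_finite unfolding R_def by blast
    have "holo R V (r' ds)" for ds
    proof (cases "ds \<in> L")
      case True
      then show ?thesis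
        using holo_mono[OF S[OF True], of R V] R by (auto simp: r'_def R_def)
    qed (use R in \<open>simp add: r'_def holo_const'\<close>)
    moreover have "holo R V h" by (rule holo_mono[OF T]) (use R in \<open>auto simp: R_def\<close>)
    ultimately show "ideal_at F p f"
      by (intro ideal_atI[OF *(1,2) _ *(3,4), of R r'])
         (use *(6) in \<open>auto simp: r'_def intro!: arg_cong2[where f = "(/)"] sum.cong\<close>)
  qed
next
  assume v: "\<forall>p\<in>\<Omega> \<inter> eqn_manifold F. ideal_at F p f"
  show "vanishes F \<Omega> f"
    unfolding vanishes_def
  proof
    fix p assume "p \<in> \<Omega> \<inter> eqn_manifold F"
    then have "ideal_at F p f" using v by blast
    then obtain V h L r S where "open V" "p \<in> V" "holo S V h" "denominator F V h" "finite L" "\<And>ds. holo S V (r ds)"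
     "\<And>q. q \<in> V \<Longrightarrow> h q \<noteq> 0 \<Longrightarrow> f q = (\<Sum>ds\<in>L. r ds q * consequence F ds q) / h q"
      by (rule ideal_atE) (rule that)
    then show "\<exists>V h L r. open V \<and> p \<in> V \<and> denominator F V h \<and> finite L \<and> (\<forall>ds\<in>L. \<exists>S. holo S V (r ds)) \<and>
     (\<forall>q\<in>V. h q \<noteq> 0 \<longrightarrow> f q = (\<Sum>ds\<in>L. r ds q * consequence F ds q) / h q)"
      by (intro exI[of _ V] exI[of _ h] exI[of _ L] exI[of _ r]) auto
  qed
qed

lemma vanishes_mult:
  assumes f: "vanishes F \<Omega> f" and g: "loc_mero F \<Omega> g"
  shows "vanishes F \<Omega> (\<lambda>q. g q * f q)"
  unfolding vanishes_iff_ideal_at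
proof
  fix p assume p: "p \<in> \<Omega> \<inter> eqn_manifold F"
  have "ideal_at F p f" using f p by (simp add: vanishes_iff_ideal_at)
  then obtain V h L r S where V: "open V" "p \<in> V" "holo S V h" "denominator F V h" "finite L" "\<And>ds. holo S V (r ds)"
     "\<And>q. q \<in> V \<Longrightarrow> h q \<noteq> 0 \<Longrightarrow> f q = (\<Sum>ds\<in>L. r ds q * consequence F ds q) / h q"
    by (rule ideal_atE) (rule that)
  obtain T where T: "finite T" "fraction_at F T p g" using g p unfolding loc_mero_iff by auto
  from T(2) obtain W a k where W: "open W" "p \<in> W" "holo T W a" "holo T W k" "denominator F W k"
    "\<And>q. q \<in> W \<Longrightarrow> k q \<noteq> 0 \<Longrightarrow> g q = a q / k q"
    by (rule fraction_atE) (rule that)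
  have o: "open (V \<inter> W)" using V W by auto
  have S: "finite (S \<union> T)" using V(3) T holo_finite by blast
  have *: "holo (S \<union> T) (V \<inter> W) h" "\<And>ds. holo (S \<union> T) (V \<inter> W) (r ds)"
      "holo (S \<union> T) (V \<inter> W) a" "holo (S \<union> T) (V \<inter> W) k"
    using V W S by (auto intro: holo_mono)
  have d: "denominator F (V \<inter> W) h" "denominator F (V \<inter> W) k"
    using V W by (auto intro: denominator_subset)
  show "ideal_at F p (\<lambda>q. g q * f q)"
    by (rule ideal_atI[where r = "\<lambda>ds q. a q * r ds q", OF o _ holo_mult[OF *(4,1)] denominator_mult[OF o d(2,1)] V(5)])
       (use V W * in \<open>auto simp: sum_distrib_left sum_divide_distrib mult.assoc intro: holo_mult\<close>)
qed

lemma vanishes_add: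
  assumes f: "vanishes F \<Omega> f" and g: "vanishes F \<Omega> g"
  shows "vanishes F \<Omega> (\<lambda>q. f q + g q)"
  unfolding vanishes_iff_ideal_at
proof
  fix p assume p: "p \<in> \<Omega> \<inter> eqn_manifold F"
  have "ideal_at F p f" using f p by (simp add: vanishes_iff_ideal_at)
  then obtain V h L r S where V: "open V" "p \<in> V" "holo S V h" "denominator F V h" "finite L" "\<And>ds. holo S V (r ds)"
     "\<And>q. q \<in> V \<Longrightarrow> h q \<noteq> 0 \<Longrightarrow> f q = (\<Sum>ds\<in>L. r ds q * consequence F ds q) / h q"
    by (rule ideal_atE) (rule that)
  have "ideal_at F p g" using g p by (simp add: vanishes_iff_ideal_at)
  then obtain W k M s T where W: "open W" "p \<in> W" "holo T W k" "denominator F W k" "finite M" "\<And>ds. holo T W (s ds)"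
     "\<And>q. q \<in> W \<Longrightarrow> k q \<noteq> 0 \<Longrightarrow> g q = (\<Sum>ds\<in>M. s ds q * consequence F ds q) / k q"
    by (rule ideal_atE) (rule that)
  have o: "open (V \<inter> W)" using V W by auto
  have S: "finite (S \<union> T)" using V(3) W(3) holo_finite by blast
  have *: "holo (S \<union> T) (V \<inter> W) h" "\<And>ds. holo (S \<union> T) (V \<inter> W) (r ds)"
      "holo (S \<union> T) (V \<inter> W) k" "\<And>ds. holo (S \<union> T) (V \<inter> W) (s ds)"
    using V W S by (auto intro: holo_mono)
  have d: "denominator F (V \<inter> W) h" "denominator F (V \<inter> W) k"
    using V W by (auto intro: denominator_subset)
  define r' where "r' = (\<lambda>ds q. (if ds \<in> L then 1 else 0) * (k q * r ds q) + (if ds \<in> M then 1 else 0) * (h q * s ds q))"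
  have r': "holo (S \<union> T) (V \<inter> W) (r' ds)" for ds
    unfolding r'_def by (intro holo_add holo_mult holo_const' * S)
  show "ideal_at F p (\<lambda>q. f q + g q)"
  proof (rule ideal_atI[OF o _ holo_mult[OF *(1,3)] denominator_mult[OF o d] _ r'])
    show "finite (L \<union> M)" using V W by simp
    fix q assume q: "q \<in> V \<inter> W" "h q * k q \<noteq> 0"
    have "(\<Sum>ds\<in>L \<union> M. r' ds q * consequence F ds q) =
       (\<Sum>ds\<in>L \<union> M. (if ds \<in> L then k q * r ds q * consequence F ds q else 0)) +
       (\<Sum>ds\<in>L \<union> M. (if ds \<in> M then h q * s ds q * consequence F ds q else 0))"
      by (subst sum.distrib[symmetric]) (auto intro!: sum.cong simp: r'_def algebra_simps)
    also have "\<dots> = (\<Sum>ds\<in>L. k q * r ds q * consequence F ds q) + (\<Sum>ds\<in>M. h q * s ds q * consequence F ds q)"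
      using V(5) W(5) by (simp add: sum.If_cases Int_absorb1)
    also have "\<dots> = k q * (\<Sum>ds\<in>L. r ds q * consequence F ds q) + h q * (\<Sum>ds\<in>M. s ds q * consequence F ds q)"
      by (simp add: sum_distrib_left mult.assoc)
    finally show "f q + g q = (\<Sum>ds\<in>L \<union> M. r' ds q * consequence F ds q) / (h q * k q)"
      using q V(7) W(7) by (simp add: field_simps)
  qed (use V W in auto)
qed

lemma vanishes_0 [simp]: "vanishes F \<Omega> (\<lambda>_. 0)"
  unfolding vanishes_iff_ideal_at
  by (intro ballI ideal_atI[of UNIV _ "{}" "\<lambda>_. 1" _ "{}" "\<lambda>_ _. 0"] denominator_const) auto

lemma vanishes_consequence: "vanishes F \<Omega> (consequence F ds)"
  unfolding vanishes_iff_ideal_at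
  by (intro ballI ideal_atI[of UNIV _ "{}" "\<lambda>_. 1" _ "{ds}" "\<lambda>_ _. 1"] denominator_const) auto

lemma vanishes_minus: "vanishes F \<Omega> f \<Longrightarrow> vanishes F \<Omega> (\<lambda>q. - f q)"
  using vanishes_mult[of F \<Omega> f "\<lambda>_. -1"] by simp

lemma vanishes_diff: "vanishes F \<Omega> f \<Longrightarrow> vanishes F \<Omega> g \<Longrightarrow> vanishes F \<Omega> (\<lambda>q. f q - g q)"
  using vanishes_add[of F \<Omega> f "\<lambda>q. - g q"] vanishes_minus[of F \<Omega> g] by simp

lemma vanishes_sum:
  "(\<And>i. i \<in> I \<Longrightarrow> vanishes F \<Omega> (f i)) \<Longrightarrow> vanishes F \<Omega> (\<lambda>q. \<Sum>i\<in>I. f i q)"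
  by (induction I rule: infinite_finite_induct) (auto intro: vanishes_add)

lemma vanishes_cong:
  assumes f: "vanishes F \<Omega> f" and g: "generically F \<Omega> (\<lambda>q. g q = f q)"
  shows "vanishes F \<Omega> g"
  unfolding vanishes_iff_ideal_at
proof
  fix p assume p: "p \<in> \<Omega> \<inter> eqn_manifold F"
  have "ideal_at F p f" using f p by (simp add: vanishes_iff_ideal_at)
  then obtain V h L r S where V: "open V" "p \<in> V" "holo S V h" "denominator F V h" "finite L" "\<And>ds. holo S V (r ds)"
     "\<And>q. q \<in> V \<Longrightarrow> h q \<noteq> 0 \<Longrightarrow> f q = (\<Sum>ds\<in>L. r ds q * consequence F ds q) / h q"
    by (rule ideal_atE) (rule that)
  obtain T where T: "finite T" "generic_at F T p (\<lambda>q. g q = f q)" using g p unfolding generically_def by auto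
  from T(2) obtain W k where W: "open W" "p \<in> W" "holo T W k" "denominator F W k" "\<And>q. q \<in> W \<Longrightarrow> k q \<noteq> 0 \<Longrightarrow> g q = f q"
    by (rule generic_atE) (rule that)
  have o: "open (V \<inter> W)" using V W by auto
  have S: "finite (S \<union> T)" using V(3) T holo_finite by blast
  have *: "holo (S \<union> T) (V \<inter> W) h" "\<And>ds. holo (S \<union> T) (V \<inter> W) (r ds)" "holo (S \<union> T) (V \<inter> W) k"
    using V W S by (auto intro: holo_mono)
  have d: "denominator F (V \<inter> W) h" "denominator F (V \<inter> W) k"
    using V W by (auto intro: denominator_subset)
  show "ideal_at F p g"
    by (rule ideal_atI[where r = "\<lambda>ds q. k q * r ds q", OF o _ holo_mult[OF *(3,1)] denominator_mult[OF o d(2,1)] V(5)])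
       (use V W * in \<open>auto simp: sum_distrib_left[symmetric] mult.assoc intro: holo_mult\<close>)
qed

text \<open>Absorbing the denominator into the coefficients makes them meromorphic, so that the
  Leibniz rule applies term by term. The region is a single point because \<open>L\<close> may vary
  from point to point.\<close>

lemma vanishes_mero_combination:
  assumes "vanishes F {p} f"
  obtains L m where "finite L" "\<And>ds. loc_mero F {p} (m ds)"
    "generically F {p} (\<lambda>q. f q = (\<Sum>ds\<in>L. m ds q * consequence F ds q))"
proof (cases "p \<in> eqn_manifold F")
  case True
  then have "ideal_at F p f" using assms by (simp add: vanishes_iff_ideal_at)
  then obtain V h L r S where V: "open V" "p \<in> V" "holo S V h" "denominator F V h" "finite L" "\<And>ds. holo S V (r ds)"
     "\<And>q. q \<in> V \<Longrightarrow> h q \<noteq> 0 \<Longrightarrow> f q = (\<Sum>ds\<in>L. r ds q * consequence F ds q) / h q"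
    by (rule ideal_atE) (rule that)
  have S: "finite S" using V(3) by (rule holo_finite)
  have "fraction_at F S p (\<lambda>q. r ds q / h q)" for ds
    by (rule fraction_atI[OF V(1,2,6,3,4)]) simp
  then have "loc_mero F {p} (\<lambda>q. r ds q / h q)" for ds
    using S unfolding loc_mero_iff by auto
  moreover have "generic_at F S p (\<lambda>q. f q = (\<Sum>ds\<in>L. r ds q / h q * consequence F ds q))"
    by (rule generic_atI[OF V(1-4)]) (simp add: V(7) sum_divide_distrib)
  then have "generically F {p} (\<lambda>q. f q = (\<Sum>ds\<in>L. r ds q / h q * consequence F ds q))"
    using S unfolding generically_def by auto
  ultimately show ?thesis by (rule that[OF V(5)])
next
  case False
  \<comment> \<open>Off the manifold a generic identity is vacuous, so the empty combination
    serves.\<close>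
  then have "generically F {p} (\<lambda>q. f q = (\<Sum>ds\<in>{}. 0 * consequence F ds q))"
    unfolding generically_def by auto
  then show ?thesis by (rule that[of "{}" "\<lambda>_ _. 0", rotated 2]) auto
qed

subsection \<open>Total derivatives of meromorphic functions\<close>

text \<open>\<open>consequence\<close> differentiates without nonlocal variables. As
  \<open>F\<close> sees only jet coordinates, this agrees with differentiation by
  \<open>total_der A\<close> for every \<open>A\<close> (\<open>total_der_consequence\<close>), so
  the same ideal serves all coverings.\<close>

locale jet_equation =
  fixes F :: "'v point \<Rightarrow> complex"
  assumes F_holo: "\<exists>S. S \<subseteq> range Jet \<and> holo S UNIV F"
begin

lemma consequence_holo: "\<exists>S. S \<subseteq> range Jet \<and> holo S UNIV (consequence F ds)"
proof (induction ds)
  case Nil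
  then show ?case using F_holo by (simp add: consequence_def)
next
  case (Cons d ds)
  then obtain S where S: "S \<subseteq> range Jet" "holo S UNIV (consequence F ds)" by blast
  have fS: "finite S" using S(2) by (rule holo_finite)
  define T where "T = S \<union> (\<lambda>k. case k of Jet \<alpha> \<Rightarrow> Jet (add_mset d \<alpha>) | _ \<Rightarrow> k) ` S"
  have T: "finite T" "S \<subseteq> T" "T \<subseteq> range Jet" using S(1) fS by (auto simp: T_def)
  have "holo T UNIV (field_coeff (\<lambda>_ _ _. 0) d k)" if k: "k \<in> S" for k
  proof -
    obtain \<alpha> where \<alpha>: "k = Jet \<alpha>" using S(1) k by auto
    have "Jet (add_mset d \<alpha>) \<in> T" using k \<alpha> by (force simp: T_def)
    then have "holo T UNIV (\<lambda>q::'v point. q (Jet (add_mset d \<alpha>)))"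
      using T by (intro holo_mono[OF holo_coord]) auto
    then show ?thesis by (simp add: \<alpha> field_coeff.simps[abs_def])
  qed
  moreover have "holo T UNIV (pd k (consequence F ds))" for k
    by (rule holo_mono[OF holo_pd[OF open_UNIV S(2)] T(2,1)]) auto
  ultimately have "holo T UNIV (\<lambda>q. \<Sum>k\<in>S. field_coeff (\<lambda>_ _ _. 0) d k q * pd k (consequence F ds) q)"
    by (intro holo_sum holo_mult T)
  moreover have "consequence F (d # ds) = (\<lambda>q. \<Sum>k\<in>S. field_coeff (\<lambda>_ _ _. 0) d k q * pd k (consequence F ds) q)"
    using total_der_eq_sum[OF open_UNIV S(2), of _ "\<lambda>_ _ _. 0" d]
    by (intro ext) (simp add: consequence_def jet_der_def)
  ultimately show ?case using T by auto
qed

lemma total_der_consequence: "total_der A i (consequence F ds) = consequence F (i # ds)"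
proof
  fix q
  obtain S where S: "S \<subseteq> range Jet" "holo S UNIV (consequence F ds)" using consequence_holo by blast
  have "total_der A i (consequence F ds) q = total_der (\<lambda>_ _ _. 0) i (consequence F ds) q"
    using S(1) by (simp add: total_der_eq_sum[OF open_UNIV S(2)]) (rule sum.cong, auto)
  then show "total_der A i (consequence F ds) q = consequence F (i # ds) q"
    by (simp add: consequence_def jet_der_def)
qed

end

locale mero_fields = jet_equation F for F :: "'v point \<Rightarrow> complex" +
  fixes \<Omega> :: "'v point set" and A :: "'v field_coeffs"
  assumes mero_A: "loc_mero F \<Omega> (A i v)"
begin

abbreviation "D \<equiv> total_der A"

lemma loc_mero_field_coeff: "loc_mero F \<Omega> (field_coeff A i k)"
  by (cases k) (simp_all add: field_coeff.simps[abs_def] mero_A)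

lemma loc_mero_D:
  assumes f: "loc_mero F \<Omega> f"
  shows "loc_mero F \<Omega> (D i f)"
proof -
  obtain S where S: "finite S" "generically F \<Omega> (\<lambda>q. \<exists>N. open N \<and> q \<in> N \<and> holo S N f)"
    using f by (rule loc_mero_generic_holo) (rule that)
  have "loc_mero F \<Omega> (\<lambda>q. \<Sum>k\<in>S. field_coeff A i k q * pd k f q)"
    by (intro loc_mero_sum loc_mero_mult loc_mero_field_coeff loc_mero_pd f)
  then show ?thesis
    by (rule loc_mero_cong) (rule generically_mono[OF S(2)], auto intro: total_der_eq_sum)
qed

text \<open>By the Leibniz rule each term of the combination yields the next consequence with the
  same coefficient and the same consequence with coefficient \<open>D i (m ds)\<close>, which is
  again meromorphic by \<open>loc_mero_D\<close>.\<close>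

lemma vanishes_D:
  assumes f: "vanishes F \<Omega> f"
  shows "vanishes F \<Omega> (D i f)"
  unfolding vanishes_pointwise[of F \<Omega>]
proof
  fix p assume p: "p \<in> \<Omega>"
  then have sub: "{p} \<subseteq> \<Omega>" by simp
  interpret p: mero_fields F "{p}" A
    by unfold_locales (rule loc_mero_subset[OF mero_A sub])
  have "vanishes F {p} f" using vanishes_subset[OF f sub] .
  then obtain L m where L: "finite L" "\<And>ds. loc_mero F {p} (m ds)"
    "generically F {p} (\<lambda>q. f q = (\<Sum>ds\<in>L. m ds q * consequence F ds q))"
    by (rule vanishes_mero_combination) (rule that)
  have reg: "generically F {p} (\<lambda>q. \<forall>ds\<in>L. regular_at (m ds) q)"
    by (intro generically_ball L loc_mero_regular)
  have c: "regular_at (consequence F ds) q" for ds q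
    unfolding regular_at_def using consequence_holo[of ds] open_UNIV by blast
  have "vanishes F {p} (\<lambda>q. \<Sum>ds\<in>L. m ds q * consequence F (i # ds) q + D i (m ds) q * consequence F ds q)"
    by (intro vanishes_sum vanishes_add vanishes_mult vanishes_consequence L p.loc_mero_D)
  then show "vanishes F {p} (D i f)"
  proof (rule vanishes_cong)
    show "generically F {p} (\<lambda>q. D i f q =
      (\<Sum>ds\<in>L. m ds q * consequence F (i # ds) q + D i (m ds) q * consequence F ds q))"
    proof (rule generically_mono[OF generically_conj[OF generically_total_der[OF L(3)] reg]], elim conjE)
      fix q assume "D i f q = D i (\<lambda>q. \<Sum>ds\<in>L. m ds q * consequence F ds q) q" "\<forall>ds\<in>L. regular_at (m ds) q"
      then show "D i f q = (\<Sum>ds\<in>L. m ds q * consequence F (i # ds) q + D i (m ds) q * consequence F ds q)"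
        by (simp add: total_der_sum regular_at_mult c total_der_mult total_der_consequence)
    qed
  qed
qed

text \<open>\<open>total_der_commutator\<close> reduces the claim to coordinates: on independent
  variables and jets the total derivatives commute identically, on nonlocal variables by hypothesis.
  Only finitely many nonlocal variables lie in \<open>S\<close>, so their coefficients are
  simultaneously regular at generic points.\<close>

lemma vanishes_D_commutator:
  assumes A: "\<And>v. vanishes F \<Omega> (\<lambda>q. D i (D j (\<lambda>p. p (Nonloc v))) q - D j (D i (\<lambda>p. p (Nonloc v))) q)"
    and f: "loc_mero F \<Omega> f"
  shows "vanishes F \<Omega> (\<lambda>q. D i (D j f) q - D j (D i f) q)"
proof -
  obtain S where S: "finite S" "generically F \<Omega> (\<lambda>q. \<exists>N. open N \<and> q \<in> N \<and> holo S N f)"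
    using f by (rule loc_mero_generic_holo) (rule that)
  have fin: "finite {v. Nonloc v \<in> S}"
    using finite_vimageI[OF S(1), of Nonloc] by (simp add: inj_def vimage_def)
  have "(UNIV :: dir set) = {Dx, Dy, Dz, Dt}" using dir.exhaust by auto
  then have "finite (UNIV :: dir set)" by (metis finite.emptyI finite.insertI)
  then have "generically F \<Omega> (\<lambda>q. \<forall>i\<in>UNIV. \<forall>v\<in>{v. Nonloc v \<in> S}. regular_at (A i v) q)"
    by (intro generically_ball fin loc_mero_regular mero_A)
  note reg = generically_conj[OF S(2) this]
  have coeff: "vanishes F \<Omega> (\<lambda>q. D i (field_coeff A j k) q - D j (field_coeff A i k) q)" for k
  proof (cases "\<exists>v. k = Nonloc v")
    case True
    then obtain v where v: "k = Nonloc v" by blast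
    have "field_coeff A i k = D i (\<lambda>p. p (Nonloc v))" for i
      by (rule ext) (simp add: v total_der_coord)
    then show ?thesis using A by simp
  next
    case False
    then show ?thesis using total_der_field_coeff_commute[of k A i j] by simp
  qed
  have "vanishes F \<Omega> (\<lambda>q. \<Sum>k\<in>S. pd k f q * (D i (field_coeff A j k) q - D j (field_coeff A i k) q))"
    by (intro vanishes_sum vanishes_mult loc_mero_pd f coeff)
  then show ?thesis
  proof (rule vanishes_cong)
    show "generically F \<Omega> (\<lambda>q. D i (D j f) q - D j (D i f) q =
       (\<Sum>k\<in>S. pd k f q * (D i (field_coeff A j k) q - D j (field_coeff A i k) q)))"
    proof (rule generically_mono[OF reg], elim conjE exE)
      fix q N assume "\<forall>i\<in>UNIV. \<forall>v\<in>{v. Nonloc v \<in> S}. regular_at (A i v) q" "open N" "q \<in> N" "holo S N f"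
      then show "D i (D j f) q - D j (D i f) q =
         (\<Sum>k\<in>S. pd k f q * (D i (field_coeff A j k) q - D j (field_coeff A i k) q))"
        using total_der_commutator[of N q S f A i j] by (simp add: mult.commute)
    qed
  qed
qed

end

section \<open>The general heavenly equation\<close>

lemma jet_equation_ghe: "jet_equation (ghe a b c :: 'v point \<Rightarrow> complex)"
proof
  define S :: "'v coord set" where "S = (\<lambda>ds. Jet (mset ds)) `
    {[Dx, Dy], [Dz, Dt], [Dx, Dz], [Dy, Dt], [Dx, Dt], [Dy, Dz]}"
  have du: "holo S UNIV (du [i, j])"
    if "[i, j] \<in> {[Dx, Dy], [Dz, Dt], [Dx, Dz], [Dy, Dt], [Dx, Dt], [Dy, Dz]}" for i j
    unfolding du_def[abs_def] by (rule holo_mono[OF holo_coord]) (use that in \<open>auto simp: S_def\<close>)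
  have "holo S UNIV (ghe a b c)"
    unfolding ghe_def[abs_def]
    by (intro holo_add holo_mult holo_const' du) (auto simp: S_def)
  then show "\<exists>S. S \<subseteq> range Jet \<and> holo S UNIV (ghe a b c :: 'v point \<Rightarrow> complex)"
    by (intro exI[of _ S]) (auto simp: S_def)
qed

text \<open>Interpreted twice: on the larger covering for the first half of the theorem, on the
  given one for existence.\<close>

locale ghe_covering =
  fixes a b c :: complex and \<Omega> :: "'v point set" and A :: "'v field_coeffs"
  assumes abc: "a + b + c = 0" and b_nz: "b \<noteq> 0" and c_nz: "c \<noteq> 0"
    and covering: "diff_covering (ghe a b c) \<Omega> A"
    and uzt_nz: "\<And>q. q \<in> \<Omega> \<Longrightarrow> du [Dz, Dt] q \<noteq> 0"
begin

sublocale mero_fields "ghe a b c" \<Omega> A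
  using covering jet_equation_ghe
  by (simp add: mero_fields_def mero_fields_axioms_def diff_covering_def)

lemma open_\<Omega>: "open \<Omega>"
  using covering by (simp add: diff_covering_def)

lemma vanishes_commutator:
  assumes "loc_mero (ghe a b c) \<Omega> f"
  shows "vanishes (ghe a b c) \<Omega> (\<lambda>q. D i (D j f) q - D j (D i f) q)"
  by (rule vanishes_D_commutator[OF _ assms]) (use covering in \<open>simp add: diff_covering_def\<close>)

lemma loc_mero_over_uzt: "loc_mero (ghe a b c) \<Omega> f \<Longrightarrow> loc_mero (ghe a b c) \<Omega> (\<lambda>q. f q / du [Dz, Dt] q)"
  by (rule loc_mero_divide[OF _ open_\<Omega> holo_coord[of "Jet (mset [Dz, Dt])" \<Omega>, folded du_def] uzt_nz])

lemma vanishes_ghe: "vanishes (ghe a b c) \<Omega> (ghe a b c)"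
  using vanishes_consequence[of "ghe a b c" \<Omega> "[]"] by (simp add: consequence_def)

lemma generically_\<Omega>I: "(\<And>q. q \<in> \<Omega> \<Longrightarrow> P q) \<Longrightarrow> generically (ghe a b c) \<Omega> P"
  by (rule generically_mono[OF generically_member[OF open_\<Omega>]])

lemma D_ghe: "D i (ghe a b c) q =
    a * du [i, Dx, Dy] q * du [Dz, Dt] q + a * du [Dx, Dy] q * du [i, Dz, Dt] q
  + b * du [i, Dx, Dz] q * du [Dy, Dt] q + b * du [Dx, Dz] q * du [i, Dy, Dt] q
  + c * du [i, Dx, Dt] q * du [Dy, Dz] q + c * du [Dx, Dt] q * du [i, Dy, Dz] q"
  unfolding ghe_def[abs_def] by (simp add: total_der_rules)

lemma generically_regular_D:
  assumes "loc_mero (ghe a b c) \<Omega> U"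
  shows "generically (ghe a b c) \<Omega> (\<lambda>q. regular_at U q \<and> (\<forall>i. regular_at (D i U) q))"
proof -
  have "(UNIV :: dir set) = {Dx, Dy, Dz, Dt}" using dir.exhaust by auto
  then have "finite (UNIV :: dir set)" by (metis finite.emptyI finite.insertI)
  then have "generically (ghe a b c) \<Omega> (\<lambda>q. \<forall>i\<in>UNIV. regular_at (D i U) q)"
    by (intro generically_ball loc_mero_regular loc_mero_D assms)
  from generically_conj[OF loc_mero_regular[OF assms] this] show ?thesis by simp
qed

text \<open>
  The coefficients in \<open>E\<close> eliminate from \<open>c u\<^sub>z\<^sub>t\<^sup>2\<close> times the linearized equation for \<open>V\<close>
  first the second derivatives of \<open>V\<close> that contain an \<open>x\<close> or a \<open>y\<close>, by the derivatives of the
  relations, and then \<open>V\<^sub>x\<close> and \<open>V\<^sub>y\<close>, by the relations themselves.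
\<close>

lemma lin_ghe_vanishes:
  assumes U: "loc_mero (ghe a b c) \<Omega> U" and V: "loc_mero (ghe a b c) \<Omega> V"
    and lin: "vanishes (ghe a b c) \<Omega> (lin_ghe a b c A U)"
    and rel: "recursion_relations a b c \<Omega> A U V"
  shows "vanishes (ghe a b c) \<Omega> (lin_ghe a b c A V)"
proof -
  let ?v = "vanishes (ghe a b c) \<Omega>" and ?m = "loc_mero (ghe a b c) \<Omega>"
  let ?T = "du [Dz, Dt] :: 'v point \<Rightarrow> complex"
  \<comment> \<open>The relations with denominators cleared, so that their total derivatives need
    only the product rule.\<close>
  define R1 where "R1 = (\<lambda>q. c * ?T q * D Dx V q - du [Dx, Dz] q * D Dt U q
      - c * du [Dx, Dt] q * D Dz V q + ?T q * D Dx U q)"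
  define R2 where "R2 = (\<lambda>q. b * ?T q * D Dy V q + du [Dy, Dz] q * D Dt U q
      - b * du [Dy, Dt] q * D Dz V q - ?T q * D Dy U q)"
  have "?v (\<lambda>q. (c * ?T q) * (D Dx V q -
       (du [Dx, Dz] q * D Dt U q + c * du [Dx, Dt] q * D Dz V q - ?T q * D Dx U q) / (c * ?T q)))"
    using rel unfolding recursion_relations_def Let_def
    by (intro vanishes_mult loc_mero_mult loc_mero_const loc_mero_du) simp_all
  then have R1: "?v R1"
    by (rule vanishes_cong) (rule generically_\<Omega>I, use uzt_nz c_nz in \<open>simp add: R1_def field_simps\<close>)
  have "?v (\<lambda>q. (b * ?T q) * (D Dy V q -
       (- ((du [Dy, Dz] q * D Dt U q - b * du [Dy, Dt] q * D Dz V q - ?T q * D Dy U q) / (b * ?T q)))))"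
    using rel unfolding recursion_relations_def Let_def
    by (intro vanishes_mult loc_mero_mult loc_mero_const loc_mero_du) simp_all
  then have R2: "?v R2"
    by (rule vanishes_cong) (rule generically_\<Omega>I, use uzt_nz b_nz in \<open>simp add: R2_def field_simps\<close>)
  \<comment> \<open>Write F for the equation, T for u_zt and lin U for the linearized equation on
    \<open>U\<close>. Apart from the commutators, which only adjust the order of derivatives,
    \<open>E\<close> is T^2 times the sum of a T D_y(R1/T), b u_yt D_z(R1/T), c u_yz D_t(R1/T), c
    u_xz D_t(R2/T), - c u_xt D_z(R2/T), D_t(c V_z F/T), D_z(U_t F/T) and - lin U. The quotient rule
    explains all coefficients with third derivatives of u. The terms in V_yz from \<open>R1\<close>
    and \<open>R2\<close> combine to the factor -c (a + b), that is c^2.\<close>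
  define E where "E = (\<lambda>q.
      (a * ?T q * ?T q) * D Dy R1 q + (b * du [Dy, Dt] q * ?T q) * D Dz R1 q
    + (c * du [Dy, Dz] q * ?T q) * D Dt R1 q + (c * du [Dx, Dz] q * ?T q) * D Dt R2 q
    - (c * du [Dx, Dt] q * ?T q) * D Dz R2 q
    - (a * ?T q * du [Dy, Dz, Dt] q + b * du [Dy, Dt] q * du [Dz, Dz, Dt] q + c * du [Dy, Dz] q * du [Dz, Dt, Dt] q) * R1 q
    - (c * (du [Dx, Dz] q * du [Dz, Dt, Dt] q - du [Dx, Dt] q * du [Dz, Dz, Dt] q)) * R2 q
    + (c * ?T q * D Dt (D Dz V) q + ?T q * D Dz (D Dt U) q - c * du [Dz, Dt, Dt] q * D Dz V q
        - du [Dz, Dz, Dt] q * D Dt U q) * ghe a b c q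
    + (c * ?T q * D Dz V q) * D Dt (ghe a b c) q + (?T q * D Dt U q) * D Dz (ghe a b c) q
    - (?T q * ?T q) * lin_ghe a b c A U q
    + (a * c * ?T q * ?T q * du [Dx, Dt] q) * (D Dy (D Dz V) q - D Dz (D Dy V) q)
    + (a * ?T q * ?T q * du [Dx, Dz] q) * (D Dy (D Dt U) q - D Dt (D Dy U) q)
    - (a * ?T q * ?T q * du [Dx, Dy] q) * (D Dz (D Dt U) q - D Dt (D Dz U) q))"
  have E: "?v E"
    unfolding E_def
    by (intro vanishes_add vanishes_diff vanishes_mult vanishes_D R1 R2 vanishes_ghe lin vanishes_commutator
        loc_mero_add loc_mero_diff loc_mero_mult loc_mero_D loc_mero_const loc_mero_du U V)
  have "?m (\<lambda>q. 1 / c / ?T q / ?T q)"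
    by (intro loc_mero_over_uzt loc_mero_const)
  from vanishes_mult[OF E this] show ?thesis
  proof (rule vanishes_cong)
    show "generically (ghe a b c) \<Omega> (\<lambda>q. lin_ghe a b c A V q = 1 / c / ?T q / ?T q * E q)"
    proof (rule generically_mono[OF generically_conj[OF generically_member[OF open_\<Omega>]
            generically_conj[OF generically_regular_D[OF U] generically_regular_D[OF V]]]], elim conjE)
      fix q assume q: "q \<in> \<Omega>" and reg: "regular_at U q" "\<forall>i. regular_at (D i U) q"
        "regular_at V q" "\<forall>i. regular_at (D i V) q"
      have D1: "D i R1 q = c * (?T q * D i (D Dx V) q + du [i, Dz, Dt] q * D Dx V q)
        - (du [Dx, Dz] q * D i (D Dt U) q + du [i, Dx, Dz] q * D Dt U q)
        - c * (du [Dx, Dt] q * D i (D Dz V) q + du [i, Dx, Dt] q * D Dz V q)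
        + (?T q * D i (D Dx U) q + du [i, Dz, Dt] q * D Dx U q)" for i
        unfolding R1_def using reg by (simp add: total_der_rules algebra_simps)
      have D2: "D i R2 q = b * (?T q * D i (D Dy V) q + du [i, Dz, Dt] q * D Dy V q)
        + (du [Dy, Dz] q * D i (D Dt U) q + du [i, Dy, Dz] q * D Dt U q)
        - b * (du [Dy, Dt] q * D i (D Dz V) q + du [i, Dy, Dt] q * D Dz V q)
        - (?T q * D i (D Dy U) q + du [i, Dz, Dt] q * D Dy U q)" for i
        unfolding R2_def using reg by (simp add: total_der_rules algebra_simps)
      have perm: "du [Dy, Dx, Dt] q = du [Dx, Dy, Dt] q" "du [Dy, Dx, Dz] q = du [Dx, Dy, Dz] q"
        "du [Dz, Dx, Dt] q = du [Dx, Dz, Dt] q" "du [Dz, Dx, Dz] q = du [Dx, Dz, Dz] q"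
        "du [Dz, Dx, Dy] q = du [Dx, Dy, Dz] q" "du [Dz, Dy, Dt] q = du [Dy, Dz, Dt] q"
        "du [Dz, Dy, Dz] q = du [Dy, Dz, Dz] q" "du [Dt, Dx, Dy] q = du [Dx, Dy, Dt] q"
        "du [Dt, Dx, Dz] q = du [Dx, Dz, Dt] q" "du [Dt, Dx, Dt] q = du [Dx, Dt, Dt] q"
        "du [Dt, Dy, Dz] q = du [Dy, Dz, Dt] q" "du [Dt, Dy, Dt] q = du [Dy, Dt, Dt] q"
        "du [Dt, Dz, Dt] q = du [Dz, Dt, Dt] q"
        by (simp_all add: du_def add_mset_commute)
      have a: "a = - b - c" using abc by (simp add: eq_neg_iff_add_eq_0 algebra_simps)
      have "c * ?T q * ?T q * lin_ghe a b c A V q = E q"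
        unfolding E_def D1 D2 D_ghe perm unfolding R1_def R2_def ghe_def lin_ghe_def Let_def a
        by algebra
      then show "lin_ghe a b c A V q = 1 / c / ?T q / ?T q * E q"
        using uzt_nz[OF q] c_nz by (simp add: field_simps)
    qed
  qed
qed

end

section \<open>Forgetting nonlocal variables\<close>

lemma inj_map_coord_Inl: "inj (map_coord Inl)"
  by (rule coord.inj_map) simp

lemma forget_apply: "forget q k = q (map_coord Inl k)"
  by (simp add: forget_def)

lemma forget_upd: "forget (q(map_coord Inl k := s)) = (forget q)(k := s)"
  by (rule ext) (auto simp: forget_apply dest: injD[OF inj_map_coord_Inl])

lemma forget_upd_other: "k \<notin> range (map_coord Inl) \<Longrightarrow> forget (q(k := s)) = forget q"
  by (rule ext) (auto simp: forget_apply)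

lemma continuous_on_forget: "continuous_on X forget"
  unfolding forget_def by (intro continuous_on_coordinatewise_then_product holo_continuous[OF holo_coord])

lemma surj_forget: "surj forget"
proof (rule surjI)
  show "forget (\<lambda>k. p (inv (map_coord Inl) k)) = p" for p
    by (rule ext) (simp add: forget_apply inv_f_f[OF inj_map_coord_Inl])
qed

lemma du_forget: "du ds (forget q) = du ds q"
  by (simp add: du_def forget_apply)

lemma ghe_forget: "ghe a b c (forget q) = ghe a b c q"
  by (simp add: ghe_def du_forget)

lemma pd_forget: "pd (map_coord Inl k) (h \<circ> forget) q = pd k h (forget q)"
  by (simp add: pd_def forget_upd forget_apply)

lemma pd_forget_other: "k \<notin> range (map_coord Inl) \<Longrightarrow> pd k (h \<circ> forget) q = 0"
  by (simp add: pd_def forget_upd_other)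

text \<open>A nonzero partial derivative of \<open>h \<circ> forget\<close> belongs to an old
  coordinate, so the two sums correspond term by term. The identity holds for every
  \<open>h\<close>, also at poles, and can therefore be iterated.\<close>

lemma total_der_forget:
  assumes "\<And>v. A' i (Inl v) q = A i v (forget q)"
  shows "total_der A' i (h \<circ> forget) q = total_der A i h (forget q)"
proof -
  have "{k. pd k (h \<circ> forget) q \<noteq> 0} = map_coord Inl ` {k. pd k h (forget q) \<noteq> 0}"
    using pd_forget[of _ h q] pd_forget_other[of _ h q] by (force simp: image_iff)
  moreover have "field_coeff A' i (map_coord Inl k) q = field_coeff A i k (forget q)" for k
    using assms by (cases k) (simp_all add: forget_apply)
  ultimately show ?thesis
    unfolding total_der_def
    by (simp add: sum.reindex inj_on_subset[OF inj_map_coord_Inl] pd_forget)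
qed

lemma consequence_forget:
  fixes q :: "('v + 'w) point"
  shows "consequence (ghe a b c) ds (forget q) = consequence (ghe a b c) ds q"
proof (induction ds arbitrary: q)
  case Nil
  then show ?case by (simp add: consequence_def ghe_forget)
next
  case (Cons d ds)
  then have "(consequence (ghe a b c) ds :: ('v + 'w) point \<Rightarrow> _) = consequence (ghe a b c) ds \<circ> forget"
    by (simp add: fun_eq_iff)
  then have "jet_der d (consequence (ghe a b c) ds) q =
      jet_der d ((consequence (ghe a b c) ds :: 'v point \<Rightarrow> _) \<circ> forget) q"
    by simp
  also have "\<dots> = jet_der d (consequence (ghe a b c) ds) (forget q)"
    unfolding jet_der_def by (rule total_der_forget) simp
  finally show ?case by (simp add: consequence_def)
qed

lemma eqn_manifold_forget: "forget q \<in> eqn_manifold (ghe a b c) \<longleftrightarrow> q \<in> eqn_manifold (ghe a b c)"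
  by (simp add: eqn_manifold_def consequence_forget)

lemma open_forget_vimage: "open V \<Longrightarrow> open (forget -` V)"
  by (rule open_vimage[OF _ continuous_on_forget])

lemma holo_forget:
  assumes "holo S V f"
  shows "holo (map_coord Inl ` S) (forget -` V) (f \<circ> forget)"
proof -
  have "(\<lambda>s. (f \<circ> forget) (q(k := s))) field_differentiable at (q k)" if "q \<in> forget -` V" for q k
  proof (cases "k \<in> range (map_coord Inl)")
    case True
    then obtain j where "k = map_coord Inl j" by auto
    then show ?thesis
      using holo_diff_at[OF assms, of "forget q" j] that by (simp add: forget_upd forget_apply)
  next
    case False
    then show ?thesis by (simp add: forget_upd_other)
  qed
  moreover have "continuous_on (forget -` V) (f \<circ> forget)"
    by (rule continuous_on_compose[OF continuous_on_forget])
       (rule continuous_on_subset[OF holo_continuous[OF assms]], auto)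
  moreover have "depends_on (map_coord Inl ` S) (forget -` V) (f \<circ> forget)"
    unfolding depends_on_def o_apply
    by (intro ballI impI) (rule holo_depends[OF assms], auto simp: forget_apply)
  ultimately show ?thesis
    unfolding holo_def using holo_finite[OF assms] by (intro conjI ballI allI) simp_all
qed

text \<open>Fixing the new coordinates at those of a point of \<open>W\<close> on the manifold cuts
  out of \<open>W\<close> a slice that is open downstairs and meets the manifold there, since the
  equation sees only jets. The nonvanishing of \<open>h\<close> on this slice lifts back to
  \<open>W\<close>.\<close>

lemma denominator_forget:
  assumes V: "open V" and h: "denominator (ghe a b c) V h"
  shows "denominator (ghe a b c) (forget -` V) (h \<circ> forget)"
proof -
  have nz: "\<exists>q\<in>W \<inter> eqn_manifold (ghe a b c). (h \<circ> forget) q \<noteq> 0"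
    if W: "open W" "W \<subseteq> forget -` V" "W \<inter> eqn_manifold (ghe a b c) \<noteq> {}" for W
  proof -
    obtain q0 where q0: "q0 \<in> W" "q0 \<in> eqn_manifold (ghe a b c)" using W by blast
    \<comment> \<open>\<open>e p\<close> is the point over \<open>p\<close> with the same forgotten coordinates as \<open>q0\<close>\<close>
    define e where "e = (\<lambda>p k. if k \<in> range (map_coord Inl) then p (inv (map_coord Inl) k) else q0 k)"
    have fe: "forget (e p) = p" for p
      by (rule ext) (simp add: forget_apply e_def inv_f_f[OF inj_map_coord_Inl])
    have e0: "e (forget q0) = q0"
      by (rule ext) (auto simp: e_def forget_apply inv_f_f[OF inj_map_coord_Inl])
    have "continuous_on UNIV e"
      unfolding e_def
    proof (rule continuous_on_coordinatewise_then_product)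
      fix k
      show "continuous_on UNIV (\<lambda>p. if k \<in> range (map_coord Inl) then p (inv (map_coord Inl) k) else q0 k)"
        by (cases "k \<in> range (map_coord Inl)") (simp_all add: holo_continuous[OF holo_coord])
    qed
    then have "open (e -` W)" by (rule open_vimage[OF W(1)])
    moreover have "e -` W \<subseteq> V" using W(2) fe by (auto simp: subset_iff)
    moreover have "forget q0 \<in> e -` W \<inter> eqn_manifold (ghe a b c)"
      using q0 e0 by (simp add: eqn_manifold_forget)
    ultimately obtain p where p: "p \<in> e -` W \<inter> eqn_manifold (ghe a b c)" "h p \<noteq> 0"
      using h unfolding denominator_def by blast
    then show ?thesis
      using fe[of p] eqn_manifold_forget[of "e p" a b c] by (intro bexI[of _ "e p"]) auto
  qed
  obtain S where "holo S V h" using h unfolding denominator_def by auto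
  then have "holo (map_coord Inl ` S) (forget -` V) (h \<circ> forget)" by (rule holo_forget)
  then have "\<exists>S. holo S (forget -` V) (h \<circ> forget)" by (rule exI)
  moreover have "\<forall>W. open W \<and> W \<subseteq> forget -` V \<and> W \<inter> eqn_manifold (ghe a b c) \<noteq> {} \<longrightarrow>
      (\<exists>q\<in>W \<inter> eqn_manifold (ghe a b c). (h \<circ> forget) q \<noteq> 0)"
    by (intro allI impI) (rule nz; simp)
  ultimately show ?thesis unfolding denominator_def by (rule conjI)
qed

lemma loc_mero_forget:
  assumes f: "loc_mero (ghe a b c) \<Omega> f" and sub: "forget ` \<Omega>' \<subseteq> \<Omega>"
  shows "loc_mero (ghe a b c) \<Omega>' (f \<circ> forget)"
proof -
  obtain S where S: "finite S" "\<And>p. p \<in> \<Omega> \<inter> eqn_manifold (ghe a b c) \<Longrightarrow> fraction_at (ghe a b c) S p f"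
    using f unfolding loc_mero_iff by auto
  have "fraction_at (ghe a b c) (map_coord Inl ` S) p (f \<circ> forget)"
    if p: "p \<in> \<Omega>' \<inter> eqn_manifold (ghe a b c)" for p
  proof -
    have "fraction_at (ghe a b c) S (forget p) f"
      using p sub by (intro S) (auto simp: eqn_manifold_forget)
    then obtain V g h where *: "open V" "forget p \<in> V" "holo S V g" "holo S V h" "denominator (ghe a b c) V h"
      "\<And>q. q \<in> V \<Longrightarrow> h q \<noteq> 0 \<Longrightarrow> f q = g q / h q"
      by (rule fraction_atE) (rule that)
    show ?thesis
      by (rule fraction_atI[OF open_forget_vimage[OF *(1)] _ holo_forget[OF *(3)] holo_forget[OF *(4)]
            denominator_forget[OF *(1,5)]]) (use * in auto)
  qed
  then show ?thesis unfolding loc_mero_iff using S(1) by (intro exI[of _ "map_coord Inl ` S"]) simp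
qed

lemma vanishes_forget:
  assumes f: "vanishes (ghe a b c) \<Omega> f" and sub: "forget ` \<Omega>' \<subseteq> \<Omega>"
  shows "vanishes (ghe a b c) \<Omega>' (f \<circ> forget)"
  unfolding vanishes_iff_ideal_at
proof
  fix p assume p: "p \<in> \<Omega>' \<inter> eqn_manifold (ghe a b c)"
  have "forget p \<in> \<Omega> \<inter> eqn_manifold (ghe a b c)"
    using p sub by (auto simp: eqn_manifold_forget)
  then have "ideal_at (ghe a b c) (forget p) f"
    by (rule bspec[OF f[unfolded vanishes_iff_ideal_at]])
  then obtain V h L r S where *: "open V" "forget p \<in> V" "holo S V h" "denominator (ghe a b c) V h"
     "finite L" "\<And>ds. holo S V (r ds)"
     "\<And>q. q \<in> V \<Longrightarrow> h q \<noteq> 0 \<Longrightarrow> f q = (\<Sum>ds\<in>L. r ds q * consequence (ghe a b c) ds q) / h q"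
    by (rule ideal_atE) (rule that)
  show "ideal_at (ghe a b c) p (f \<circ> forget)"
    by (rule ideal_atI[where r = "\<lambda>ds. r ds \<circ> forget", OF open_forget_vimage[OF *(1)] _ holo_forget[OF *(3)]
            denominator_forget[OF *(1,4)] *(5) holo_forget[OF *(6)]])
       (use * in \<open>auto simp: consequence_forget\<close>)
qed

lemma lin_ghe_forget:
  assumes "open \<Omega>'" "\<And>i v q. q \<in> \<Omega>' \<Longrightarrow> A' i (Inl v) q = A i v (forget q)" "q \<in> \<Omega>'"
  shows "lin_ghe a b c A' (U \<circ> forget) q = lin_ghe a b c A U (forget q)"
proof -
  have D: "total_der A' i (h \<circ> forget) q = (total_der A i h \<circ> forget) q" if "q \<in> \<Omega>'" for i h q
    unfolding o_apply[of "total_der A i h"] by (rule total_der_forget) (rule assms(2)[OF that])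
  have "total_der A' i (total_der A' j (U \<circ> forget)) q = total_der A i (total_der A j U) (forget q)" for i j
    using trans[OF total_der_cong[OF assms(1,3) D] D[OF assms(3)]] by (simp only: o_apply)
  then show ?thesis by (simp add: lin_ghe_def Let_def du_forget)
qed

text \<open>The pullback \<open>U \<circ> forget\<close> again satisfies the linearized equation on
  the larger covering, so that \<open>U\<close> and \<open>U'\<close> live on one space and
  \<open>lin_ghe_vanishes\<close> applies there.\<close>

lemma recursion_relations_symmetry:
  fixes \<Omega> :: "'v point set" and \<Omega>' :: "('v + 'w) point set"
  assumes abc: "a + b + c = 0" "b \<noteq> 0" "c \<noteq> 0"
    and uzt: "\<forall>q\<in>\<Omega>. du [Dz, Dt] q \<noteq> 0" and U: "symmetry a b c \<Omega> A U"
    and ext: "covering_extension a b c \<Omega> A \<Omega>' A'" and U': "loc_mero (ghe a b c) \<Omega>' U'"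
    and rel: "recursion_relations a b c \<Omega>' A' (U \<circ> forget) U'"
  shows "symmetry a b c \<Omega>' A' U'"
proof -
  have sub: "forget ` \<Omega>' \<subseteq> \<Omega>" and A': "\<And>i v q. q \<in> \<Omega>' \<Longrightarrow> A' i (Inl v) q = A i v (forget q)"
    using ext by (auto simp: covering_extension_def)
  interpret ghe_covering a b c \<Omega>' A'
  proof
    show "du [Dz, Dt] q \<noteq> 0" if "q \<in> \<Omega>'" for q
      using uzt sub that du_forget[of "[Dz, Dt]" q] by auto
  qed (use abc ext in \<open>auto simp: covering_extension_def\<close>)
  have "vanishes (ghe a b c) \<Omega>' (lin_ghe a b c A U \<circ> forget)"
    using U by (intro vanishes_forget[OF _ sub]) (simp add: symmetry_def)
  moreover have "lin_ghe a b c A' (U \<circ> forget) q = (lin_ghe a b c A U \<circ> forget) q" if "q \<in> \<Omega>'" for q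
    unfolding o_apply[of "lin_ghe a b c A U"] using A' that by (intro lin_ghe_forget[OF open_\<Omega>])
  ultimately have "vanishes (ghe a b c) \<Omega>' (lin_ghe a b c A' (U \<circ> forget))"
    by (rule vanishes_cong[OF _ generically_\<Omega>I])
  moreover have "loc_mero (ghe a b c) \<Omega>' (U \<circ> forget)"
    using U by (intro loc_mero_forget[OF _ sub]) (simp add: symmetry_def)
  ultimately show ?thesis
    using lin_ghe_vanishes[OF _ U' _ rel] U' by (simp add: symmetry_def)
qed

section \<open>The covering that carries the potential\<close>

context mero_fields
begin

text \<open>The conditions under which an operator acts on meromorphic functions modulo the ideal.
  Compatibility with differences is asked only modulo the ideal, as it may fail at poles. The
  conditions pass to compositions, hence to the powers in \<open>prolong\<close>.\<close>

definition ideal_op :: "(('v point \<Rightarrow> complex) \<Rightarrow> 'v point \<Rightarrow> complex) \<Rightarrow> bool" where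
  "ideal_op P \<longleftrightarrow> (\<forall>h. loc_mero F \<Omega> h \<longrightarrow> loc_mero F \<Omega> (P h)) \<and> (\<forall>h. vanishes F \<Omega> h \<longrightarrow> vanishes F \<Omega> (P h)) \<and>
     (\<forall>h k. loc_mero F \<Omega> h \<longrightarrow> loc_mero F \<Omega> k \<longrightarrow>
       vanishes F \<Omega> (\<lambda>q. P (\<lambda>q. h q - k q) q - (P h q - P k q)))"

definition commute_mod ::
  "(('v point \<Rightarrow> complex) \<Rightarrow> 'v point \<Rightarrow> complex) \<Rightarrow> (('v point \<Rightarrow> complex) \<Rightarrow> 'v point \<Rightarrow> complex) \<Rightarrow> bool" where
  "commute_mod P Q \<longleftrightarrow> (\<forall>h. loc_mero F \<Omega> h \<longrightarrow> vanishes F \<Omega> (\<lambda>q. P (Q h) q - Q (P h) q))"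

lemma ideal_op_mero: "ideal_op P \<Longrightarrow> loc_mero F \<Omega> h \<Longrightarrow> loc_mero F \<Omega> (P h)"
  by (simp add: ideal_op_def)

lemma ideal_op_vanishes: "ideal_op P \<Longrightarrow> vanishes F \<Omega> h \<Longrightarrow> vanishes F \<Omega> (P h)"
  by (simp add: ideal_op_def)

lemma ideal_op_diff: "ideal_op P \<Longrightarrow> loc_mero F \<Omega> h \<Longrightarrow> loc_mero F \<Omega> k \<Longrightarrow>
    vanishes F \<Omega> (\<lambda>q. P (\<lambda>q. h q - k q) q - (P h q - P k q))"
  by (simp add: ideal_op_def)

lemma commute_modD: "commute_mod P Q \<Longrightarrow> loc_mero F \<Omega> h \<Longrightarrow> vanishes F \<Omega> (\<lambda>q. P (Q h) q - Q (P h) q)"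
  by (simp add: commute_mod_def)

lemma vanishes_trans:
  assumes "vanishes F \<Omega> (\<lambda>q. f q - g q)" "vanishes F \<Omega> (\<lambda>q. g q - h q)"
  shows "vanishes F \<Omega> (\<lambda>q. f q - h q)"
  using vanishes_add[OF assms] by simp

lemma vanishes_sym: "vanishes F \<Omega> (\<lambda>q. f q - g q) \<Longrightarrow> vanishes F \<Omega> (\<lambda>q. g q - f q)"
  using vanishes_minus[of F \<Omega> "\<lambda>q. f q - g q"] by simp

lemma ideal_op_congruence:
  assumes P: "ideal_op P" and m: "loc_mero F \<Omega> h" "loc_mero F \<Omega> k" and v: "vanishes F \<Omega> (\<lambda>q. h q - k q)"
  shows "vanishes F \<Omega> (\<lambda>q. P h q - P k q)"
  using vanishes_diff[OF ideal_op_vanishes[OF P v] ideal_op_diff[OF P m]] by simp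

lemma ideal_op_id: "ideal_op (\<lambda>h. h)"
  by (simp add: ideal_op_def)

lemma commute_mod_id: "commute_mod P (\<lambda>h. h)"
  by (simp add: commute_mod_def)

lemma ideal_op_comp:
  assumes P: "ideal_op P" and Q: "ideal_op Q"
  shows "ideal_op (\<lambda>h. P (Q h))"
proof -
  have "vanishes F \<Omega> (\<lambda>q. P (Q (\<lambda>q. h q - k q)) q - (P (Q h) q - P (Q k) q))"
    if m: "loc_mero F \<Omega> h" "loc_mero F \<Omega> k" for h k
  proof -
    note Qm = ideal_op_mero[OF Q]
    have "vanishes F \<Omega> (\<lambda>q. P (Q (\<lambda>q. h q - k q)) q - P (\<lambda>q. Q h q - Q k q) q)"
      by (rule ideal_op_congruence[OF P Qm loc_mero_diff ideal_op_diff[OF Q]])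
         (intro loc_mero_diff Qm m)+
    from vanishes_trans[OF this ideal_op_diff[OF P Qm Qm]] m show ?thesis by blast
  qed
  then show ?thesis
    using P Q unfolding ideal_op_def[of "\<lambda>h. P (Q h)"] by (simp add: ideal_op_mero ideal_op_vanishes)
qed

lemma commute_mod_comp:
  assumes PQ: "commute_mod P Q" and PR: "commute_mod P R" and P: "ideal_op P" and Q: "ideal_op Q" and R: "ideal_op R"
  shows "commute_mod P (\<lambda>h. Q (R h))"
  unfolding commute_mod_def
proof (intro allI impI)
  fix h assume h: "loc_mero F \<Omega> h"
  have "vanishes F \<Omega> (\<lambda>q. Q (P (R h)) q - Q (R (P h)) q)"
    by (rule ideal_op_congruence[OF Q _ _ commute_modD[OF PR h]])
       (intro ideal_op_mero[OF P] ideal_op_mero[OF R] h)+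
  then show "vanishes F \<Omega> (\<lambda>q. P (Q (R h)) q - Q (R (P h)) q)"
    by (rule vanishes_trans[OF commute_modD[OF PQ ideal_op_mero[OF R h]]])
qed

lemma ideal_op_funpow: "ideal_op P \<Longrightarrow> ideal_op (P ^^ n)"
  by (induction n) (simp_all add: ideal_op_id ideal_op_comp id_def comp_def)

lemma commute_mod_funpow: "commute_mod P Q \<Longrightarrow> ideal_op P \<Longrightarrow> ideal_op Q \<Longrightarrow> commute_mod P (Q ^^ n)"
proof (induction n)
  case 0
  then show ?case by (simp add: commute_mod_id id_def)
next
  case (Suc n)
  then show ?case using commute_mod_comp[of P Q "Q ^^ n"] by (simp add: ideal_op_funpow comp_def)
qed

end

text \<open>
  In the coordinates \<open>x, y, m = u\<^sub>t, t\<close>, \<open>frame k\<close> is the derivative \<open>X\<^sub>k\<close> at constant \<open>m\<close> and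
  \<open>frame_m\<close> is \<open>\<partial>\<^sub>m\<close>; the right-hand sides \<open>f\<close> and \<open>g\<close> are \<open>potential_x U\<close> and \<open>potential_y U\<close>.
\<close>

context ghe_covering
begin

definition frame :: "dir \<Rightarrow> ('v point \<Rightarrow> complex) \<Rightarrow> 'v point \<Rightarrow> complex" where
  "frame k h q = D k h q - du [k, Dt] q / du [Dz, Dt] q * D Dz h q"

definition frame_m :: "('v point \<Rightarrow> complex) \<Rightarrow> 'v point \<Rightarrow> complex" where
  "frame_m h q = D Dz h q / du [Dz, Dt] q"

definition potential_x :: "('v point \<Rightarrow> complex) \<Rightarrow> 'v point \<Rightarrow> complex" where
  "potential_x U q = (du [Dx, Dz] q * D Dt U q - du [Dz, Dt] q * D Dx U q) / (c * du [Dz, Dt] q)"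

definition potential_y :: "('v point \<Rightarrow> complex) \<Rightarrow> 'v point \<Rightarrow> complex" where
  "potential_y U q = (du [Dz, Dt] q * D Dy U q - du [Dy, Dz] q * D Dt U q) / (b * du [Dz, Dt] q)"

lemma loc_mero_frame: "loc_mero (ghe a b c) \<Omega> h \<Longrightarrow> loc_mero (ghe a b c) \<Omega> (frame k h)"
  unfolding frame_def[abs_def] by (intro loc_mero_diff loc_mero_mult loc_mero_over_uzt loc_mero_D loc_mero_du)

lemma loc_mero_frame_m: "loc_mero (ghe a b c) \<Omega> h \<Longrightarrow> loc_mero (ghe a b c) \<Omega> (frame_m h)"
  unfolding frame_m_def[abs_def] by (intro loc_mero_over_uzt loc_mero_D)

lemma loc_mero_potential:
  assumes "loc_mero (ghe a b c) \<Omega> U"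
  shows "loc_mero (ghe a b c) \<Omega> (potential_x U)" "loc_mero (ghe a b c) \<Omega> (potential_y U)"
proof -
  have "loc_mero (ghe a b c) \<Omega> (\<lambda>q. 1 / c * ((du [Dx, Dz] q * D Dt U q - du [Dz, Dt] q * D Dx U q) / du [Dz, Dt] q))"
    by (intro loc_mero_diff loc_mero_mult loc_mero_over_uzt loc_mero_D loc_mero_du loc_mero_const assms)
  then show "loc_mero (ghe a b c) \<Omega> (potential_x U)" by (simp add: potential_x_def[abs_def])
  have "loc_mero (ghe a b c) \<Omega> (\<lambda>q. 1 / b * ((du [Dz, Dt] q * D Dy U q - du [Dy, Dz] q * D Dt U q) / du [Dz, Dt] q))"
    by (intro loc_mero_diff loc_mero_mult loc_mero_over_uzt loc_mero_D loc_mero_du loc_mero_const assms)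
  then show "loc_mero (ghe a b c) \<Omega> (potential_y U)" by (simp add: potential_y_def[abs_def])
qed

lemma generically_regularI:
  assumes "loc_mero (ghe a b c) \<Omega> h"
    and "\<And>q. q \<in> \<Omega> \<Longrightarrow> du [Dz, Dt] q \<noteq> 0 \<Longrightarrow> regular_at h q \<Longrightarrow> (\<And>i. regular_at (D i h) q) \<Longrightarrow> P q"
  shows "generically (ghe a b c) \<Omega> P"
  by (rule generically_mono[OF generically_conj[OF generically_member[OF open_\<Omega>] generically_regular_D[OF assms(1)]]])
     (use assms(2) uzt_nz in blast)

lemma generically_D_diff:
  assumes "loc_mero (ghe a b c) \<Omega> h" "loc_mero (ghe a b c) \<Omega> k"
  shows "generically (ghe a b c) \<Omega> (\<lambda>q. \<forall>i. D i (\<lambda>q. h q - k q) q = D i h q - D i k q)"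
  by (rule generically_mono[OF generically_conj[OF loc_mero_regular[OF assms(1)] loc_mero_regular[OF assms(2)]]])
     (auto intro: total_der_diff)

lemma ideal_op_frame: "ideal_op (frame k)"
proof -
  have "vanishes (ghe a b c) \<Omega> (frame k h)" if "vanishes (ghe a b c) \<Omega> h" for h
    unfolding frame_def[abs_def]
    by (intro vanishes_diff vanishes_mult vanishes_D that loc_mero_over_uzt loc_mero_du)
  moreover have "vanishes (ghe a b c) \<Omega> (\<lambda>q. frame k (\<lambda>q. h q - l q) q - (frame k h q - frame k l q))"
    if "loc_mero (ghe a b c) \<Omega> h" "loc_mero (ghe a b c) \<Omega> l" for h l
    by (rule vanishes_cong[OF vanishes_0 generically_mono[OF generically_D_diff[OF that]]])
       (simp add: frame_def right_diff_distrib)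
  ultimately show ?thesis by (simp add: ideal_op_def loc_mero_frame)
qed

lemma ideal_op_frame_m: "ideal_op frame_m"
proof -
  have "vanishes (ghe a b c) \<Omega> (frame_m h)" if "vanishes (ghe a b c) \<Omega> h" for h
  proof -
    have "vanishes (ghe a b c) \<Omega> (\<lambda>q. 1 / du [Dz, Dt] q * D Dz h q)"
      by (intro vanishes_mult vanishes_D that loc_mero_over_uzt loc_mero_const)
    then show ?thesis by (simp add: frame_m_def[abs_def])
  qed
  moreover have "vanishes (ghe a b c) \<Omega> (\<lambda>q. frame_m (\<lambda>q. h q - l q) q - (frame_m h q - frame_m l q))"
    if "loc_mero (ghe a b c) \<Omega> h" "loc_mero (ghe a b c) \<Omega> l" for h l
    by (rule vanishes_cong[OF vanishes_0 generically_mono[OF generically_D_diff[OF that]]])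
       (simp add: frame_m_def diff_divide_distrib)
  ultimately show ?thesis by (simp add: ideal_op_def loc_mero_frame_m)
qed

lemma D_frame:
  assumes "du [Dz, Dt] q \<noteq> 0" "regular_at h q" "\<And>i. regular_at (D i h) q"
  shows "D i (frame k h) q = D i (D k h) q - (du [k, Dt] q / du [Dz, Dt] q * D i (D Dz h) q +
    (du [i, k, Dt] q * du [Dz, Dt] q - du [k, Dt] q * du [i, Dz, Dt] q) / (du [Dz, Dt] q * du [Dz, Dt] q) * D Dz h q)"
  unfolding frame_def[abs_def] using assms(1)
  by (simp add: total_der_rules assms) (simp add: field_simps assms(1))

text \<open>Each \<open>frame k\<close> annihilates u_t, so these operators are coordinate fields.
  In the calculation the derivatives of the coefficients u_kt/u_zt cancel because u_klt is
  symmetric, leaving a combination of commutators of total derivatives.\<close>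

lemma commute_mod_frame: "commute_mod (frame k) (frame l)"
  unfolding commute_mod_def
proof (intro allI impI)
  fix h assume h: "loc_mero (ghe a b c) \<Omega> h"
  let ?n = "\<lambda>k q. du [k, Dt] q / du [Dz, Dt] q"
  have "vanishes (ghe a b c) \<Omega> (\<lambda>q. (D k (D l h) q - D l (D k h) q)
     - ?n l q * (D k (D Dz h) q - D Dz (D k h) q) + ?n k q * (D l (D Dz h) q - D Dz (D l h) q))"
    by (intro vanishes_diff vanishes_add vanishes_mult vanishes_commutator h loc_mero_over_uzt loc_mero_du)
  then show "vanishes (ghe a b c) \<Omega> (\<lambda>q. frame k (frame l h) q - frame l (frame k h) q)"
  proof (rule vanishes_cong, intro generically_regularI[OF h])
    fix q assume nz: "du [Dz, Dt] q \<noteq> 0" and reg: "regular_at h q" "\<And>i. regular_at (D i h) q"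
    note D = D_frame[OF nz reg]
    have perm: "du [l, k, Dt] q = du [k, l, Dt] q" "du [Dz, k, Dt] q = du [k, Dz, Dt] q"
       "du [Dz, l, Dt] q = du [l, Dz, Dt] q"
      by (simp_all add: du_def add_mset_commute)
    show "frame k (frame l h) q - frame l (frame k h) q = (D k (D l h) q - D l (D k h) q)
     - ?n l q * (D k (D Dz h) q - D Dz (D k h) q) + ?n k q * (D l (D Dz h) q - D Dz (D l h) q)"
      unfolding frame_def[of k "frame l h"] frame_def[of l "frame k h"] D perm
      using nz by (simp add: field_simps)
  qed
qed

lemma commute_mod_frame_m: "commute_mod (frame k) frame_m"
  unfolding commute_mod_def
proof (intro allI impI)
  fix h assume h: "loc_mero (ghe a b c) \<Omega> h"
  have "vanishes (ghe a b c) \<Omega> (\<lambda>q. 1 / du [Dz, Dt] q * (D k (D Dz h) q - D Dz (D k h) q))"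
    by (intro vanishes_mult vanishes_commutator h loc_mero_over_uzt loc_mero_const)
  then show "vanishes (ghe a b c) \<Omega> (\<lambda>q. frame k (frame_m h) q - frame_m (frame k h) q)"
  proof (rule vanishes_cong, intro generically_regularI[OF h])
    fix q assume nz: "du [Dz, Dt] q \<noteq> 0" and reg: "regular_at h q" "\<And>i. regular_at (D i h) q"
    have D: "D i (frame_m h) q = (D i (D Dz h) q * du [Dz, Dt] q - D Dz h q * du [i, Dz, Dt] q) / (du [Dz, Dt] q * du [Dz, Dt] q)" for i
      unfolding frame_m_def[abs_def] using nz reg by (simp add: total_der_rules)
    have perm: "du [Dz, k, Dt] q = du [k, Dz, Dt] q"
      by (simp add: du_def add_mset_commute)
    show "frame k (frame_m h) q - frame_m (frame k h) q = 1 / du [Dz, Dt] q * (D k (D Dz h) q - D Dz (D k h) q)"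
      unfolding frame_def[of k "frame_m h"] frame_m_def[of "frame k h"] D D_frame[OF nz reg] perm
      using nz by (simp add: field_simps)
  qed
qed

text \<open>Existence uses the linearized equation for \<open>U\<close> here. The coefficients of
  U_xy in X_y f and X_x g are -1/c and 1/b, so b c times the difference contains -(b + c) U_xy = a
  U_xy, as the linearized equation divided by u_zt does.\<close>

lemma vanishes_potential_compatible:
  assumes U: "loc_mero (ghe a b c) \<Omega> U" and lin: "vanishes (ghe a b c) \<Omega> (lin_ghe a b c A U)"
  shows "vanishes (ghe a b c) \<Omega> (\<lambda>q. frame Dy (potential_x U) q - frame Dx (potential_y U) q)"
proof -
  let ?T = "du [Dz, Dt] :: 'v point \<Rightarrow> complex"
  \<comment> \<open>With F the equation and T = u_zt, the last two lines are -T^2 D_z(U_t F/T). They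
    trade the term a u_xy U_zt of the linearized equation for terms without u_xy and supply u_xyz.
    The commutators adjust the order of derivatives.\<close>
  define E where "E = (\<lambda>q. (?T q * ?T q) * lin_ghe a b c A U q
    + (?T q * ?T q * b * du [Dx, Dz] q) * (D Dy (D Dt U) q - D Dt (D Dy U) q)
    - (?T q * ?T q * c * ?T q) * (D Dx (D Dy U) q - D Dy (D Dx U) q)
    + (?T q * ?T q * c * du [Dy, Dz] q) * (D Dx (D Dt U) q - D Dt (D Dx U) q)
    + (?T q * ?T q * a * du [Dx, Dy] q) * (D Dz (D Dt U) q - D Dt (D Dz U) q)
    + (du [Dz, Dz, Dt] q * D Dt U q - ?T q * D Dz (D Dt U) q) * ghe a b c q
    - (?T q * D Dt U q) * D Dz (ghe a b c) q)"
  have E: "vanishes (ghe a b c) \<Omega> E"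
    unfolding E_def
    by (intro vanishes_add vanishes_diff vanishes_mult vanishes_D vanishes_ghe lin vanishes_commutator
        loc_mero_add loc_mero_diff loc_mero_mult loc_mero_D loc_mero_const loc_mero_du U)
  have "loc_mero (ghe a b c) \<Omega> (\<lambda>q. 1 / (b * c) / ?T q / ?T q / ?T q)"
    by (intro loc_mero_over_uzt loc_mero_const)
  from vanishes_mult[OF E this] show ?thesis
  proof (rule vanishes_cong, intro generically_regularI[OF U])
    fix q assume nz: "?T q \<noteq> 0" and reg: "regular_at U q" "\<And>i. regular_at (D i U) q"
    have Dx: "D i (potential_x U) q = ((du [Dx, Dz] q * D i (D Dt U) q + du [i, Dx, Dz] q * D Dt U q
        - (?T q * D i (D Dx U) q + du [i, Dz, Dt] q * D Dx U q)) * (c * ?T q)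
        - (du [Dx, Dz] q * D Dt U q - ?T q * D Dx U q) * (c * du [i, Dz, Dt] q)) / ((c * ?T q) * (c * ?T q))" for i
      unfolding potential_x_def[abs_def] using nz reg c_nz by (simp add: total_der_rules)
    have Dy: "D i (potential_y U) q = ((?T q * D i (D Dy U) q + du [i, Dz, Dt] q * D Dy U q
        - (du [Dy, Dz] q * D i (D Dt U) q + du [i, Dy, Dz] q * D Dt U q)) * (b * ?T q)
        - (?T q * D Dy U q - du [Dy, Dz] q * D Dt U q) * (b * du [i, Dz, Dt] q)) / ((b * ?T q) * (b * ?T q))" for i
      unfolding potential_y_def[abs_def] using nz reg b_nz by (simp add: total_der_rules)
    have perm: "du [Dy, Dx, Dz] q = du [Dx, Dy, Dz] q" "du [Dz, Dx, Dy] q = du [Dx, Dy, Dz] q"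
        "du [Dz, Dx, Dt] q = du [Dx, Dz, Dt] q" "du [Dz, Dx, Dz] q = du [Dx, Dz, Dz] q"
        "du [Dz, Dy, Dt] q = du [Dy, Dz, Dt] q" "du [Dz, Dy, Dz] q = du [Dy, Dz, Dz] q"
      by (simp_all add: du_def add_mset_commute)
    have a: "a = - b - c" using abc by (simp add: eq_neg_iff_add_eq_0 algebra_simps)
    have fy: "b * c * (?T q * ?T q * ?T q) * frame Dy (potential_x U) q =
       b * ?T q * ((du [Dx, Dz] q * D Dy (D Dt U) q + du [Dx, Dy, Dz] q * D Dt U q
        - (?T q * D Dy (D Dx U) q + du [Dy, Dz, Dt] q * D Dx U q)) * ?T q
        - (du [Dx, Dz] q * D Dt U q - ?T q * D Dx U q) * du [Dy, Dz, Dt] q)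
       - b * du [Dy, Dt] q * ((du [Dx, Dz] q * D Dz (D Dt U) q + du [Dx, Dz, Dz] q * D Dt U q
        - (?T q * D Dz (D Dx U) q + du [Dz, Dz, Dt] q * D Dx U q)) * ?T q
        - (du [Dx, Dz] q * D Dt U q - ?T q * D Dx U q) * du [Dz, Dz, Dt] q)"
      unfolding frame_def Dx perm using nz b_nz c_nz by (simp add: field_simps)
    have fx: "b * c * (?T q * ?T q * ?T q) * frame Dx (potential_y U) q =
       c * ?T q * ((?T q * D Dx (D Dy U) q + du [Dx, Dz, Dt] q * D Dy U q
        - (du [Dy, Dz] q * D Dx (D Dt U) q + du [Dx, Dy, Dz] q * D Dt U q)) * ?T q
        - (?T q * D Dy U q - du [Dy, Dz] q * D Dt U q) * du [Dx, Dz, Dt] q)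
       - c * du [Dx, Dt] q * ((?T q * D Dz (D Dy U) q + du [Dz, Dz, Dt] q * D Dy U q
        - (du [Dy, Dz] q * D Dz (D Dt U) q + du [Dy, Dz, Dz] q * D Dt U q)) * ?T q
        - (?T q * D Dy U q - du [Dy, Dz] q * D Dt U q) * du [Dz, Dz, Dt] q)"
      unfolding frame_def Dy perm using nz b_nz c_nz by (simp add: field_simps)
    have "b * c * (?T q * ?T q * ?T q) * frame Dy (potential_x U) q -
       b * c * (?T q * ?T q * ?T q) * frame Dx (potential_y U) q = E q"
      unfolding fy fx E_def D_ghe perm unfolding ghe_def lin_ghe_def Let_def a by algebra
    then show "frame Dy (potential_x U) q - frame Dx (potential_y U) q = 1 / (b * c) / ?T q / ?T q / ?T q * E q"
      using nz b_nz c_nz by (simp add: field_simps)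
  qed
qed

text \<open>With \<open>frame_m\<close> outermost, one more \<open>frame_m\<close> is an exact
  identity (\<open>prolong_Suc_m\<close>), while one more \<open>frame Dt\<close> has to be moved
  inwards and is correct only modulo the ideal (\<open>vanishes_frame_t_prolong\<close>).\<close>

definition prolong :: "nat \<Rightarrow> nat \<Rightarrow> ('v point \<Rightarrow> complex) \<Rightarrow> 'v point \<Rightarrow> complex" where
  "prolong r s h = (frame_m ^^ r) ((frame Dt ^^ s) h)"

lemma ideal_op_prolong: "ideal_op (prolong r s)"
  using ideal_op_comp[OF ideal_op_funpow[OF ideal_op_frame_m] ideal_op_funpow[OF ideal_op_frame]]
  by (simp add: prolong_def[abs_def])

lemma commute_mod_prolong: "commute_mod (frame k) (prolong r s)"
  using commute_mod_comp[OF commute_mod_funpow commute_mod_funpow ideal_op_frame ideal_op_funpow ideal_op_funpow,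
      OF commute_mod_frame_m _ _ commute_mod_frame]
  by (simp add: prolong_def[abs_def] ideal_op_frame ideal_op_frame_m)

lemma prolong_Suc_m: "prolong (Suc r) s h = frame_m (prolong r s h)"
  by (simp add: prolong_def)

lemma vanishes_frame_t_prolong:
  assumes "loc_mero (ghe a b c) \<Omega> h"
  shows "vanishes (ghe a b c) \<Omega> (\<lambda>q. frame Dt (prolong r s h) q - prolong r (Suc s) h q)"
  using commute_modD[OF commute_mod_funpow[OF commute_mod_frame_m ideal_op_frame ideal_op_frame_m]
      ideal_op_mero[OF ideal_op_funpow[OF ideal_op_frame] assms]]
  by (simp add: prolong_def)

text \<open>\<open>prolong r s\<close> commutes with \<open>frame Dx\<close> and
  \<open>frame Dy\<close> modulo the ideal and respects congruences, so it carries the compatibility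
  of the potentials to all orders.\<close>

lemma vanishes_prolong_compatible:
  assumes U: "loc_mero (ghe a b c) \<Omega> U" and lin: "vanishes (ghe a b c) \<Omega> (lin_ghe a b c A U)"
  shows "vanishes (ghe a b c) \<Omega>
    (\<lambda>q. frame Dy (prolong r s (potential_x U)) q - frame Dx (prolong r s (potential_y U)) q)"
proof -
  note m = loc_mero_potential[OF U] and pm = ideal_op_mero[OF ideal_op_prolong]
  note c = commute_modD[OF commute_mod_prolong]
  have "vanishes (ghe a b c) \<Omega> (\<lambda>q. prolong r s (frame Dy (potential_x U)) q - prolong r s (frame Dx (potential_y U)) q)"
    by (rule ideal_op_congruence[OF ideal_op_prolong _ _ vanishes_potential_compatible[OF assms]])
       (intro loc_mero_frame m)+
  from vanishes_trans[OF vanishes_trans[OF c[OF m(1)] this] vanishes_sym[OF c[OF m(2)]]]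
  show ?thesis .
qed

text \<open>
  The nonlocal variable \<open>Inr (r, s)\<close> stands for \<open>\<partial>\<^sub>m\<^sup>r X\<^sub>t\<^sup>s U'\<close>. Its total derivatives are given by
  \<open>D\<^sub>k = X\<^sub>k + u\<^sub>t\<^sub>k \<partial>\<^sub>m\<close>, and \<open>lift_rest\<close> is the part coming from \<open>X\<^sub>k\<close>, where \<open>X\<^sub>z = 0\<close>.
\<close>

definition lift_rest ::
  "('v point \<Rightarrow> complex) \<Rightarrow> dir \<Rightarrow> nat \<Rightarrow> nat \<Rightarrow> ('v + nat \<times> nat) point \<Rightarrow> complex" where
  "lift_rest U i r s = (case i of
       Dx \<Rightarrow> prolong r s (potential_x U) \<circ> forget
     | Dy \<Rightarrow> prolong r s (potential_y U) \<circ> forget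
     | Dz \<Rightarrow> (\<lambda>_. 0)
     | Dt \<Rightarrow> (\<lambda>q. q (Nonloc (Inr (r, Suc s)))))"

definition lift_fields :: "('v point \<Rightarrow> complex) \<Rightarrow> ('v + nat \<times> nat) field_coeffs" where
  "lift_fields U i v = (case v of
       Inl v \<Rightarrow> A i v \<circ> forget
     | Inr (r, s) \<Rightarrow> (\<lambda>q. lift_rest U i r s q + du [i, Dt] q * q (Nonloc (Inr (Suc r, s)))))"

abbreviation lift_\<Omega> :: "('v + nat \<times> nat) point set" where
  "lift_\<Omega> \<equiv> forget -` \<Omega>"

lemma lift_\<Omega>: "forget ` lift_\<Omega> = \<Omega>" "forget ` lift_\<Omega> \<subseteq> \<Omega>" "open lift_\<Omega>"
proof -
  show "forget ` lift_\<Omega> = \<Omega>" by (rule surj_image_vimage_eq[OF surj_forget])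
  then show "forget ` lift_\<Omega> \<subseteq> \<Omega>" by simp
  show "open lift_\<Omega>" by (rule open_forget_vimage[OF open_\<Omega>])
qed

lemma lift_fields_Inl: "lift_fields U i (Inl v) q = A i v (forget q)"
  by (simp add: lift_fields_def)

lemma total_der_lift_forget: "total_der (lift_fields U) i (h \<circ> forget) q = D i h (forget q)"
  by (rule total_der_forget) (rule lift_fields_Inl)

lemma total_der_lift_new:
  "total_der (lift_fields U) i (\<lambda>q. q (Nonloc (Inr (r, s)))) q =
     lift_rest U i r s q + du [i, Dt] q * q (Nonloc (Inr (Suc r, s)))"
  by (simp add: total_der_coord lift_fields_def)

lemma loc_mero_lift_rest:
  assumes "loc_mero (ghe a b c) \<Omega> U"
  shows "loc_mero (ghe a b c) lift_\<Omega> (lift_rest U i r s)"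
  using loc_mero_potential[OF assms]
  by (cases i) (simp_all add: lift_rest_def loc_mero_forget[OF _ lift_\<Omega>(2)] ideal_op_mero[OF ideal_op_prolong])

lemma mero_fields_lift:
  assumes "loc_mero (ghe a b c) \<Omega> U"
  shows "mero_fields (ghe a b c) lift_\<Omega> (lift_fields U)"
proof -
  have "loc_mero (ghe a b c) lift_\<Omega> (lift_fields U i v)" for i v
  proof (cases v)
    case (Inl v)
    then show ?thesis using loc_mero_forget[OF mero_A lift_\<Omega>(2)] by (simp add: lift_fields_def)
  next
    case (Inr rs)
    then show ?thesis
      by (cases rs) (simp add: lift_fields_def loc_mero_add loc_mero_mult loc_mero_lift_rest[OF assms])
  qed
  then show ?thesis
    using jet_equation_ghe by (simp add: mero_fields_def mero_fields_axioms_def)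
qed

text \<open>In D_i D_j of the variable w(r, s) the terms u_ijt w(r+1, s) and u_it u_jt w(r+2, s) are
  symmetric in i and j; the commutator is what remains. Pairs containing z cancel exactly by the
  definition of \<open>frame_m\<close>, pairs of t with x or y reduce to
  \<open>vanishes_frame_t_prolong\<close>, and the pair x, y is the compatibility condition.\<close>

lemma vanishes_lift_rest:
  assumes U: "loc_mero (ghe a b c) \<Omega> U" and lin: "vanishes (ghe a b c) \<Omega> (lin_ghe a b c A U)"
  shows "vanishes (ghe a b c) lift_\<Omega> (\<lambda>q.
      total_der (lift_fields U) i (lift_rest U j r s) q + du [j, Dt] q * lift_rest U i (Suc r) s q
    - (total_der (lift_fields U) j (lift_rest U i r s) q + du [i, Dt] q * lift_rest U j (Suc r) s q))"
    (is "vanishes _ _ (\<lambda>q. ?K i j q - ?K j i q)")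
proof -
  let ?v = "vanishes (ghe a b c) lift_\<Omega>"
  have cong: "?v g" if "vanishes (ghe a b c) \<Omega> f" "\<And>q. q \<in> lift_\<Omega> \<Longrightarrow> g q = f (forget q)" for f g
    by (rule vanishes_cong[OF vanishes_forget[OF that(1) lift_\<Omega>(2)]])
       (rule generically_mono[OF generically_member[OF lift_\<Omega>(3)]], simp add: that(2))
  have nz: "du [Dz, Dt] q \<noteq> 0" if "q \<in> lift_\<Omega>" for q
    using uzt_nz[of "forget q"] that by (simp add: du_forget)
  note simps = lift_rest_def total_der_lift_forget total_der_lift_forget[unfolded comp_def] total_der_lift_new prolong_Suc_m frame_def frame_m_def du_forget
  have xy: "?v (\<lambda>q. ?K Dy Dx q - ?K Dx Dy q)"
    by (rule cong[OF vanishes_prolong_compatible[OF assms, of r s]]) (simp add: simps field_simps nz)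
  have z: "?v (\<lambda>q. ?K Dz i q - ?K i Dz q)" if "i = Dx \<or> i = Dy \<or> i = Dt" for i
    by (rule cong[OF vanishes_0]) (use that nz in \<open>auto simp: simps\<close>)
  have tx: "?v (\<lambda>q. ?K Dt Dx q - ?K Dx Dt q)"
    by (rule cong[OF vanishes_frame_t_prolong[OF loc_mero_potential(1)[OF U], of r s]]) (simp add: simps field_simps nz)
  have ty: "?v (\<lambda>q. ?K Dt Dy q - ?K Dy Dt q)"
    by (rule cong[OF vanishes_frame_t_prolong[OF loc_mero_potential(2)[OF U], of r s]]) (simp add: simps field_simps nz)
  have swap: "?v (\<lambda>q. ?K i j q - ?K j i q)" if "?v (\<lambda>q. ?K j i q - ?K i j q)" for i j
    using vanishes_minus[OF that] by (simp only: minus_diff_eq)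
  have same: "?v (\<lambda>q. ?K i i q - ?K i i q)" for i
    by simp
  show ?thesis
  proof (cases i)
    case Dx
    then show ?thesis
      by (cases j; hypsubst) (rule same, rule swap[OF xy], rule swap[OF z], simp, rule swap[OF tx])
  next
    case Dy
    then show ?thesis
      by (cases j; hypsubst) (rule xy, rule same, rule swap[OF z], simp, rule swap[OF ty])
  next
    case Dz
    then show ?thesis
      by (cases j; hypsubst) (rule z, simp, rule z, simp, rule same, rule z, simp)
  next
    case Dt
    then show ?thesis
      by (cases j; hypsubst) (rule tx, rule ty, rule swap[OF z], simp, rule same)
  qed
qed

lemma diff_covering_lift:
  assumes U: "loc_mero (ghe a b c) \<Omega> U" and lin: "vanishes (ghe a b c) \<Omega> (lin_ghe a b c A U)"
  shows "diff_covering (ghe a b c) lift_\<Omega> (lift_fields U)"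
proof -
  interpret lift: mero_fields "ghe a b c" lift_\<Omega> "lift_fields U" by (rule mero_fields_lift[OF U])
  have "vanishes (ghe a b c) lift_\<Omega> (\<lambda>q. lift.D i (lift.D j (\<lambda>p. p (Nonloc v))) q -
          lift.D j (lift.D i (\<lambda>p. p (Nonloc v))) q)" for i j v
  proof (cases v)
    case (Inl v)
    have "lift.D i (lift.D j (\<lambda>p. p (Nonloc (Inl v)))) q =
        ((\<lambda>p. D i (D j (\<lambda>p. p (Nonloc v))) p) \<circ> forget) q" for i j q
    proof -
      have "lift.D j (\<lambda>p. p (Nonloc (Inl v))) = D j (\<lambda>p. p (Nonloc v)) \<circ> forget"
        by (rule ext) (simp add: total_der_coord lift_fields_Inl)
      then show ?thesis by (simp only: total_der_lift_forget o_apply)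
    qed
    moreover have "vanishes (ghe a b c) \<Omega> (\<lambda>q. D i (D j (\<lambda>p. p (Nonloc v))) q - D j (D i (\<lambda>p. p (Nonloc v))) q)"
      by (rule vanishes_commutator) simp
    note vanishes_forget[OF this lift_\<Omega>(2)]
    ultimately show ?thesis by (simp add: Inl comp_def)
  next
    case (Inr rs)
    then obtain r s where v: "v = Inr (r, s)" by (cases rs) auto
    let ?w = "\<lambda>q. q (Nonloc (Inr (Suc r, s)))"
    note K = vanishes_lift_rest[OF assms, of i j r s]
    have reg: "generically (ghe a b c) lift_\<Omega> (\<lambda>q. regular_at (lift_rest U i r s) q \<and> regular_at (lift_rest U j r s) q)"
      by (intro generically_conj loc_mero_regular loc_mero_lift_rest U)
    have D: "lift.D i (lift.D j (\<lambda>p. p (Nonloc v))) q =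
        lift.D i (lift_rest U j r s) q + du [i, j, Dt] q * ?w q
        + du [j, Dt] q * (lift_rest U i (Suc r) s q + du [i, Dt] q * q (Nonloc (Inr (Suc (Suc r), s))))"
      if "regular_at (lift_rest U j r s) q" for i j q
    proof -
      have "lift.D j (\<lambda>p. p (Nonloc v)) = (\<lambda>q. lift_rest U j r s q + du [j, Dt] q * ?w q)"
        by (rule ext) (simp add: v total_der_lift_new)
      then show ?thesis
        using that by (simp add: total_der_rules total_der_lift_new)
    qed
    show ?thesis
    proof (rule vanishes_cong[OF K generically_mono[OF reg]], elim conjE)
      fix q assume r: "regular_at (lift_rest U i r s) q" "regular_at (lift_rest U j r s) q"
      have perm: "du [j, i, Dt] q = du [i, j, Dt] q"
        by (simp add: du_def add_mset_commute)
      show "lift.D i (lift.D j (\<lambda>p. p (Nonloc v))) q - lift.D j (lift.D i (\<lambda>p. p (Nonloc v))) q =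
          lift.D i (lift_rest U j r s) q + du [j, Dt] q * lift_rest U i (Suc r) s q
        - (lift.D j (lift_rest U i r s) q + du [i, Dt] q * lift_rest U j (Suc r) s q)"
        unfolding D[OF r(1)] D[OF r(2)] perm by (simp add: algebra_simps)
    qed
  qed
  then show ?thesis
    using lift_\<Omega>(3) lift.mero_A by (simp add: diff_covering_def)
qed

text \<open>For w(0, 0) in the role of U' the covering gives U'_x = f + u_xt w(1, 0) and U'_z = u_zt
  w(1, 0). Eliminating w(1, 0) leaves the first relation, and the second arises in the same way;
  both hold identically on \<open>lift_\<Omega>\<close>.\<close>

lemma recursion_relations_lift:
  "recursion_relations a b c lift_\<Omega> (lift_fields U) (U \<circ> forget) (\<lambda>q. q (Nonloc (Inr (0, 0))))"
proof -
  have nz: "du [Dz, Dt] q \<noteq> 0" if "q \<in> lift_\<Omega>" for q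
    using uzt_nz[of "forget q"] that by (simp add: du_forget)
  have van: "vanishes (ghe a b c) lift_\<Omega> f" if "\<And>q. q \<in> lift_\<Omega> \<Longrightarrow> f q = 0" for f
    by (rule vanishes_cong[OF vanishes_0 generically_mono[OF generically_member[OF lift_\<Omega>(3)]]]) (rule that)
  show ?thesis
    unfolding recursion_relations_def Let_def total_der_lift_new total_der_lift_forget
    by (intro conjI; rule van)
       (simp_all add: lift_rest_def prolong_def potential_x_def potential_y_def du_forget nz b_nz c_nz field_simps)
qed

lemma covering_extension_lift:
  assumes "symmetry a b c \<Omega> A U"
  shows "covering_extension a b c \<Omega> A lift_\<Omega> (lift_fields U)"
  using assms diff_covering_lift[of U] lift_\<Omega>(1)
  by (simp add: covering_extension_def symmetry_def lift_fields_Inl)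

end

text \<open>The second conjunct keeps the first from being vacuous: after adjoining countably many
  nonlocal variables the relations have a meromorphic solution, and the first conjunct with
  \<open>'w\<close> taken as \<open>nat \<times> nat\<close> applies to it.\<close>

theorem mainTheorem3:
  fixes a b c :: complex
    and \<Omega> :: "'v point set" and A :: "'v field_coeffs" and U :: "'v point \<Rightarrow> complex"
  assumes "a + b + c = 0" and "b \<noteq> 0" and "c \<noteq> 0"
    and "diff_covering (ghe a b c) \<Omega> A"
    and "\<forall>q\<in>\<Omega>. du [Dz, Dt] q \<noteq> 0"
    and "symmetry a b c \<Omega> A U"
  shows "(\<forall>(\<Omega>' :: ('v + 'w) point set) A' U'.
            covering_extension a b c \<Omega> A \<Omega>' A' \<and>
            loc_mero (ghe a b c) \<Omega>' U' \<and>
            recursion_relations a b c \<Omega>' A' (U \<circ> forget) U'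
            \<longrightarrow> symmetry a b c \<Omega>' A' U')
       \<and> (\<exists>(\<Omega>' :: ('v + nat \<times> nat) point set) A' U'.
            covering_extension a b c \<Omega> A \<Omega>' A' \<and>
            loc_mero (ghe a b c) \<Omega>' U' \<and>
            recursion_relations a b c \<Omega>' A' (U \<circ> forget) U')"
proof (intro conjI allI impI)
  fix \<Omega>' :: "('v + 'w) point set" and A' U'
  assume "covering_extension a b c \<Omega> A \<Omega>' A' \<and> loc_mero (ghe a b c) \<Omega>' U' \<and>
    recursion_relations a b c \<Omega>' A' (U \<circ> forget) U'"
  then show "symmetry a b c \<Omega>' A' U'"
    using recursion_relations_symmetry[OF assms(1-3,5,6)] by blast
next
  interpret ghe_covering a b c \<Omega> A
    using assms by unfold_locales auto
  show "\<exists>(\<Omega>' :: ('v + nat \<times> nat) point set) A' U'.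
      covering_extension a b c \<Omega> A \<Omega>' A' \<and> loc_mero (ghe a b c) \<Omega>' U' \<and>
      recursion_relations a b c \<Omega>' A' (U \<circ> forget) U'"
    using covering_extension_lift[OF assms(6)] loc_mero_coord recursion_relations_lift by blast
qed

end
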